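(* The system $\mathsf B_0+(\exists^2)+\mathsf{QF\text{-}AC}^{1,1}$ proves $\mathsf{ATR}\leftrightarrow\mathsf{ATR}^{\mathrm{st}}$, where $\mathsf{ATR}$ is the sentence $$(\forall X^1,f^1)\big[\mathrm{WO}(X)\to(\exists Y^1)H_f(X,Y)\big].$$
   Context: Finite types are generated from $0$ (natural numbers) by $\to$; type $n+1$ is $n\to0$; superscripts on variables denote types. $\mathsf{E\text{-}EFA}^\omega$ is the extensional finite-type arithmetic of first-order strength $\mathsf{EFA}=I\Delta_0+\mathrm{EXP}$, namely Kohlenbach's system $\mathsf{E\text{-}G}_3\mathsf A^\omega$ ("Applied Proof Theory", Ch. 3). The nonstandard language adds unary predicates $\mathrm{st}^\sigma$ and quantifiers $\forall^{\mathrm{st}}x^\sigma,\exists^{\mathrm{st}}x^\sigma$ for every finite type $\sigma$; formulas without these symbols are called internal. $\mathsf{E\text{-}EFA}^{\omega}_{\mathrm{st}}$ is $\mathsf{E\text{-}EFA}^\omega$ plus: (EQ) $\forall^{\mathrm{st}}x\,\Phi(x)\leftrightarrow\forall x(\mathrm{st}(x)\to\Phi(x))$ and $\exists^{\mathrm{st}}x\,\Phi(x)\leftrightarrow\exists x(\mathrm{st}(x)\wedge\Phi(x))$ for arbitrary $\Phi$; ($\mathcal T_{\mathrm{st}}$) $\mathrm{st}(x)\wedge x=y\to\mathrm{st}(y)$; $\mathrm{st}(t)$ for each closed term $t$; $\mathrm{st}(f)\wedge\mathrm{st}(x)\to\mathrm{st}(fx)$; $\mathrm{st}^0(x)\wedge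 y\le x\to\mathrm{st}^0(y)$. Finite sequences of objects of type $\sigma$ are coded as single objects of type $\sigma$, such that every object codes a finite sequence; $x\in y$ means $x$ equals a component of the sequence coded by $y$; $\cup$ is concatenation; for $Y$ of type $\sigma\to\tau$, $Y[x]:=\bigcup_{f\in Y}f(x)$. Further axioms ($\varphi$ internal; $A$ quantifier-free internal): ($\mathsf I$) $\forall^{\mathrm{st}}y'\,\exists x\,\forall y\in y'\,\varphi(x,y)\to\exists x\,\forall^{\mathrm{st}}y\,\varphi(x,y)$; ($\mathsf{HAC}_{\mathrm{int}}$) $\forall^{\mathrm{st}}x^\sigma\,\exists^{\mathrm{st}}y^\tau\,\varphi(x,y)\to\exists^{\mathrm{st}}Y^{\sigma\to\tau}\,\forall^{\mathrm{st}}x^\sigma\,\exists y^\tau\in Y[x]\ \varphi(x,y)$ (parameters allowed in both); ($\mathsf{PF\text{-}TP}_\forall$) $\forall^{\mathrm{st}}\underline x\,\varphi(\underline x)\to\forall\underline x\,\varphi(\underline x)$, where $\varphi(\underline x)$ has no free variables besides $\underline x$; ($\mathsf{QF\text{-}AC}^{\sigma,\tau}$) $(\forall x^\sigma)(\exists y^\tau)A(x,y)\to(\exists Y^{\sigma\to\tau})(\forall x^\sigma)A(x,Y(x))$ (tuples of variables of the indicated type levels are allowed). $\mathsf B_0:=\mathsf{E\text{-}EFA}^{\omega}_{\mathrm{st}}+\mathsf I+\mathsf{HAC}_{\mathrm{int}}+\mathsf{PF\text{-}TP}_\forall+\mathsf{QF\text{-}AC}^{1,0}$. $(\exists^2)$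 is the axiom $(\exists\varphi^2)(\forall f^1)(\varphi(f)=0\leftrightarrow(\exists x^0)f(x)=0)$. $\mathrm{WO}(X)$ expresses (as in Simpson's "Subsystems of Second Order Arithmetic", V.2) that $X$ codes a countable well-ordering $\le_X$ (a linear order on its field without infinite descending sequence). $H_f(X,Y)$ expresses that $Y$ is the result of iterating the formula $\theta(n,Z)\equiv(\exists m^0)(f(m,n,\overline Zm)=0)$ along $X$, i.e. $Y$ is the set of pairs $(n,j)$ with $j$ in the field of $X$ and $\theta(n,Y^j)$, where $Y^j=\{(m,i):i<_Xj\wedge(m,i)\in Y\}$; here $\overline Zm$ is the length-$m$ initial segment of (the characteristic function of) $Z$, and sets of naturals are represented by type $1$ objects. $\mathsf{ATR}^{\mathrm{st}}$ is obtained from $\mathsf{ATR}$ by relativizing all quantifiers (except bounded number quantifiers) to "st". *)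

theory Defs
  imports Main
begin

section \<open>Finite types, terms and formulas\<close>

text \<open>\<open>N\<close> is the type \<open>0\<close> of natural numbers.\<close>

datatype ty = N | Arr ty ty (infixr "\<rightharpoonup>" 75)

primrec targs :: "ty \<Rightarrow> ty list" where
  "targs N = []"
| "targs (\<sigma> \<rightharpoonup> \<tau>) = \<sigma> # targs \<tau>"

primrec ty_level :: "ty \<Rightarrow> nat" where
  "ty_level N = 0"
| "ty_level (\<sigma> \<rightharpoonup> \<tau>) = max (Suc (ty_level \<sigma>)) (ty_level \<tau>)"

text \<open>The constants of Kohlenbach's \<open>E-G\<^sub>3A\<^sup>\<omega>\<close>: \<open>cA0\<close> to \<open>cA3\<close> are the first branches of the
  Ackermann function (successor of the second argument, sum, product, power); \<open>cPhi1\<close> to \<open>cPhi3\<close>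
  map \<open>f, x\<close> to the maximum, sum and product of \<open>f 0, \<dots>, f x\<close>; \<open>cMu\<close> is bounded search;
  \<open>cR \<rho>\<close> is bounded predicative recursion; \<open>cPi\<close> and \<open>cSig\<close> are the combinators.\<close>

datatype cst = cZero | cSucc | cMin | cMax | cA0 | cA1 | cA2 | cA3 | cPhi1 | cPhi2 | cPhi3
  | cMu | cR ty | cPi ty ty | cSig ty ty ty

primrec cty :: "cst \<Rightarrow> ty" where
  "cty cZero = N"
| "cty cSucc = N \<rightharpoonup> N"
| "cty cMin = N \<rightharpoonup> N \<rightharpoonup> N"
| "cty cMax = N \<rightharpoonup> N \<rightharpoonup> N"
| "cty cA0 = N \<rightharpoonup> N \<rightharpoonup> N"
| "cty cA1 = N \<rightharpoonup> N \<rightharpoonup> N"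
| "cty cA2 = N \<rightharpoonup> N \<rightharpoonup> N"
| "cty cA3 = N \<rightharpoonup> N \<rightharpoonup> N"
| "cty cPhi1 = (N \<rightharpoonup> N) \<rightharpoonup> N \<rightharpoonup> N"
| "cty cPhi2 = (N \<rightharpoonup> N) \<rightharpoonup> N \<rightharpoonup> N"
| "cty cPhi3 = (N \<rightharpoonup> N) \<rightharpoonup> N \<rightharpoonup> N"
| "cty cMu = (N \<rightharpoonup> N \<rightharpoonup> N) \<rightharpoonup> N \<rightharpoonup> N"
| "cty (cR \<rho>) = N \<rightharpoonup> \<rho> \<rightharpoonup> (N \<rightharpoonup> N \<rightharpoonup> \<rho>) \<rightharpoonup> (N \<rightharpoonup> \<rho>) \<rightharpoonup> \<rho>"
| "cty (cPi \<rho> \<tau>) = \<rho> \<rightharpoonup> \<tau> \<rightharpoonup> \<rho>"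
| "cty (cSig \<delta> \<rho> \<tau>) = (\<delta> \<rightharpoonup> \<rho> \<rightharpoonup> \<tau>) \<rightharpoonup> (\<delta> \<rightharpoonup> \<rho>) \<rightharpoonup> \<delta> \<rightharpoonup> \<tau>"

type_synonym var = "nat \<times> ty"

datatype tm = V var | C cst | App tm tm (infixl "\<cdot>" 200)

primrec tyof :: "tm \<Rightarrow> ty option" where
  "tyof (V x) = Some (snd x)"
| "tyof (C c) = Some (cty c)"
| "tyof (s \<cdot> t) = (case tyof s of
      Some (\<sigma> \<rightharpoonup> \<tau>) \<Rightarrow> (if tyof t = Some \<sigma> then Some \<tau> else None)
    | _ \<Rightarrow> None)"

primrec fvt :: "tm \<Rightarrow> var set" where
  "fvt (V x) = {x}"
| "fvt (C c) = {}"
| "fvt (s \<cdot> t) = fvt s \<union> fvt t"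

primrec tsubst :: "tm \<Rightarrow> (var \<Rightarrow> tm) \<Rightarrow> tm" where
  "tsubst (V x) \<theta> = \<theta> x"
| "tsubst (C c) \<theta> = C c"
| "tsubst (s \<cdot> t) \<theta> = tsubst s \<theta> \<cdot> tsubst t \<theta>"

abbreviation apps :: "tm \<Rightarrow> tm list \<Rightarrow> tm" where
  "apps \<equiv> foldl App"

text \<open>\<open>Eq\<close> and \<open>Le\<close> are the primitive relations between objects of type \<open>0\<close>; equality at higher
  types is defined below. As in the paper the quantifiers \<open>ForallSt\<close>, \<open>ExistsSt\<close> are primitive
  symbols, governed only by the axioms (EQ).\<close>

datatype fm =
    Eq tm tm
  | Le tm tm
  | St ty tm
  | Bot
  | Imp fm fm (infixr "\<^bold>\<longrightarrow>" 55)
  | Conj fm fm (infixr "\<^bold>\<and>" 65)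
  | Disj fm fm (infixr "\<^bold>\<or>" 60)
  | Forall var fm
  | Exists var fm
  | ForallSt var fm
  | ExistsSt var fm

abbreviation Neg :: "fm \<Rightarrow> fm" ("\<^bold>\<not> _" [70] 70) where
  "\<^bold>\<not> \<phi> \<equiv> \<phi> \<^bold>\<longrightarrow> Bot"

abbreviation Iff :: "fm \<Rightarrow> fm \<Rightarrow> fm" (infix "\<^bold>\<longleftrightarrow>" 52) where
  "\<phi> \<^bold>\<longleftrightarrow> \<psi> \<equiv> (\<phi> \<^bold>\<longrightarrow> \<psi>) \<^bold>\<and> (\<psi> \<^bold>\<longrightarrow> \<phi>)"

primrec wff :: "fm \<Rightarrow> bool" where
  "wff (Eq s t) = (tyof s = Some N \<and> tyof t = Some N)"
| "wff (Le s t) = (tyof s = Some N \<and> tyof t = Some N)"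
| "wff (St \<sigma> t) = (tyof t = Some \<sigma>)"
| "wff Bot = True"
| "wff (\<phi> \<^bold>\<longrightarrow> \<psi>) = (wff \<phi> \<and> wff \<psi>)"
| "wff (\<phi> \<^bold>\<and> \<psi>) = (wff \<phi> \<and> wff \<psi>)"
| "wff (\<phi> \<^bold>\<or> \<psi>) = (wff \<phi> \<and> wff \<psi>)"
| "wff (Forall x \<phi>) = wff \<phi>"
| "wff (Exists x \<phi>) = wff \<phi>"
| "wff (ForallSt x \<phi>) = wff \<phi>"
| "wff (ExistsSt x \<phi>) = wff \<phi>"

primrec fv :: "fm \<Rightarrow> var set" where
  "fv (Eq s t) = fvt s \<union> fvt t"
| "fv (Le s t) = fvt s \<union> fvt t"
| "fv (St \<sigma> t) = fvt t"
| "fv Bot = {}"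
| "fv (\<phi> \<^bold>\<longrightarrow> \<psi>) = fv \<phi> \<union> fv \<psi>"
| "fv (\<phi> \<^bold>\<and> \<psi>) = fv \<phi> \<union> fv \<psi>"
| "fv (\<phi> \<^bold>\<or> \<psi>) = fv \<phi> \<union> fv \<psi>"
| "fv (Forall x \<phi>) = fv \<phi> - {x}"
| "fv (Exists x \<phi>) = fv \<phi> - {x}"
| "fv (ForallSt x \<phi>) = fv \<phi> - {x}"
| "fv (ExistsSt x \<phi>) = fv \<phi> - {x}"

primrec internal :: "fm \<Rightarrow> bool" where
  "internal (Eq s t) = True"
| "internal (Le s t) = True"
| "internal (St \<sigma> t) = False"
| "internal Bot = True"
| "internal (\<phi> \<^bold>\<longrightarrow> \<psi>) = (internal \<phi> \<and> internal \<psi>)"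
| "internal (\<phi> \<^bold>\<and> \<psi>) = (internal \<phi> \<and> internal \<psi>)"
| "internal (\<phi> \<^bold>\<or> \<psi>) = (internal \<phi> \<and> internal \<psi>)"
| "internal (Forall x \<phi>) = internal \<phi>"
| "internal (Exists x \<phi>) = internal \<phi>"
| "internal (ForallSt x \<phi>) = False"
| "internal (ExistsSt x \<phi>) = False"

text \<open>Quantifier-free internal formulas.\<close>

primrec qf :: "fm \<Rightarrow> bool" where
  "qf (Eq s t) = True"
| "qf (Le s t) = True"
| "qf (St \<sigma> t) = False"
| "qf Bot = True"
| "qf (\<phi> \<^bold>\<longrightarrow> \<psi>) = (qf \<phi> \<and> qf \<psi>)"
| "qf (\<phi> \<^bold>\<and> \<psi>) = (qf \<phi> \<and> qf \<psi>)"
| "qf (\<phi> \<^bold>\<or> \<psi>) = (qf \<phi> \<and> qf \<psi>)"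
| "qf (Forall x \<phi>) = False"
| "qf (Exists x \<phi>) = False"
| "qf (ForallSt x \<phi>) = False"
| "qf (ExistsSt x \<phi>) = False"

definition fresh :: "ty \<Rightarrow> var set \<Rightarrow> var" where
  "fresh \<sigma> A = (LEAST n. (n, \<sigma>) \<notin> A, \<sigma>)"

text \<open>Capture-avoiding simultaneous substitution: a bound variable is renamed only if it occurs
  in one of the terms being substituted below its quantifier.\<close>

definition bvar :: "(var \<Rightarrow> tm) \<Rightarrow> var \<Rightarrow> fm \<Rightarrow> var" where
  "bvar \<theta> x \<phi> =
    (let A = (\<Union>z \<in> fv \<phi> - {x}. fvt (\<theta> z)) in if x \<in> A then fresh (snd x) A else x)"

primrec psubst :: "fm \<Rightarrow> (var \<Rightarrow> tm) \<Rightarrow> fm" where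
  "psubst (Eq s t) \<theta> = Eq (tsubst s \<theta>) (tsubst t \<theta>)"
| "psubst (Le s t) \<theta> = Le (tsubst s \<theta>) (tsubst t \<theta>)"
| "psubst (St \<sigma> t) \<theta> = St \<sigma> (tsubst t \<theta>)"
| "psubst Bot \<theta> = Bot"
| "psubst (\<phi> \<^bold>\<longrightarrow> \<psi>) \<theta> = psubst \<phi> \<theta> \<^bold>\<longrightarrow> psubst \<psi> \<theta>"
| "psubst (\<phi> \<^bold>\<and> \<psi>) \<theta> = psubst \<phi> \<theta> \<^bold>\<and> psubst \<psi> \<theta>"
| "psubst (\<phi> \<^bold>\<or> \<psi>) \<theta> = psubst \<phi> \<theta> \<^bold>\<or> psubst \<psi> \<theta>"
| "psubst (Forall x \<phi>) \<theta> =
    (let y = bvar \<theta> x \<phi> in Forall y (psubst \<phi> (\<theta>(x := V y))))"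
| "psubst (Exists x \<phi>) \<theta> =
    (let y = bvar \<theta> x \<phi> in Exists y (psubst \<phi> (\<theta>(x := V y))))"
| "psubst (ForallSt x \<phi>) \<theta> =
    (let y = bvar \<theta> x \<phi> in ForallSt y (psubst \<phi> (\<theta>(x := V y))))"
| "psubst (ExistsSt x \<phi>) \<theta> =
    (let y = bvar \<theta> x \<phi> in ExistsSt y (psubst \<phi> (\<theta>(x := V y))))"

abbreviation subst :: "fm \<Rightarrow> var \<Rightarrow> tm \<Rightarrow> fm" where
  "subst \<phi> x t \<equiv> psubst \<phi> (V(x := t))"


section \<open>Many-sorted classical predicate logic\<close>

text \<open>\<open>derives T \<Gamma> \<phi>\<close>: natural deduction of \<open>\<phi>\<close> from the (open) assumptions \<open>\<Gamma>\<close> and the axioms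
  \<open>T\<close>. An axiom with free variables stands for its universal closure, so the eigenvariable
  conditions concern only \<open>\<Gamma>\<close>. The logic has no rules for \<open>St\<close>, \<open>ForallSt\<close>, \<open>ExistsSt\<close>, and
  equality is axiomatised.\<close>

inductive derives :: "fm set \<Rightarrow> fm set \<Rightarrow> fm \<Rightarrow> bool" for T where
  Ax: "\<phi> \<in> T \<Longrightarrow> derives T \<Gamma> \<phi>"
| Asm: "\<phi> \<in> \<Gamma> \<Longrightarrow> wff \<phi> \<Longrightarrow> derives T \<Gamma> \<phi>"
| Weak: "derives T \<Gamma> \<phi> \<Longrightarrow> \<Gamma> \<subseteq> \<Delta> \<Longrightarrow> derives T \<Delta> \<phi>"
| BotE: "derives T \<Gamma> Bot \<Longrightarrow> wff \<phi> \<Longrightarrow> derives T \<Gamma> \<phi>"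
| Class: "derives T (insert (\<^bold>\<not> \<phi>) \<Gamma>) Bot \<Longrightarrow> wff \<phi> \<Longrightarrow> derives T \<Gamma> \<phi>"
| ImpI: "derives T (insert \<phi> \<Gamma>) \<psi> \<Longrightarrow> wff \<phi> \<Longrightarrow> derives T \<Gamma> (\<phi> \<^bold>\<longrightarrow> \<psi>)"
| ImpE: "derives T \<Gamma> (\<phi> \<^bold>\<longrightarrow> \<psi>) \<Longrightarrow> derives T \<Gamma> \<phi> \<Longrightarrow> derives T \<Gamma> \<psi>"
| ConjI: "derives T \<Gamma> \<phi> \<Longrightarrow> derives T \<Gamma> \<psi> \<Longrightarrow> derives T \<Gamma> (\<phi> \<^bold>\<and> \<psi>)"
| ConjE1: "derives T \<Gamma> (\<phi> \<^bold>\<and> \<psi>) \<Longrightarrow> derives T \<Gamma> \<phi>"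
| ConjE2: "derives T \<Gamma> (\<phi> \<^bold>\<and> \<psi>) \<Longrightarrow> derives T \<Gamma> \<psi>"
| DisjI1: "derives T \<Gamma> \<phi> \<Longrightarrow> wff \<psi> \<Longrightarrow> derives T \<Gamma> (\<phi> \<^bold>\<or> \<psi>)"
| DisjI2: "derives T \<Gamma> \<psi> \<Longrightarrow> wff \<phi> \<Longrightarrow> derives T \<Gamma> (\<phi> \<^bold>\<or> \<psi>)"
| DisjE: "derives T \<Gamma> (\<phi> \<^bold>\<or> \<psi>) \<Longrightarrow> derives T (insert \<phi> \<Gamma>) \<chi> \<Longrightarrow> derives T (insert \<psi> \<Gamma>) \<chi>
    \<Longrightarrow> derives T \<Gamma> \<chi>"
| ForallI: "derives T \<Gamma> (subst \<phi> x (V y)) \<Longrightarrow> snd y = snd x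
    \<Longrightarrow> y \<notin> (\<Union>\<psi>\<in>\<Gamma>. fv \<psi>) \<union> fv (Forall x \<phi>) \<Longrightarrow> derives T \<Gamma> (Forall x \<phi>)"
| ForallE: "derives T \<Gamma> (Forall x \<phi>) \<Longrightarrow> tyof t = Some (snd x) \<Longrightarrow> derives T \<Gamma> (subst \<phi> x t)"
| ExistsI: "derives T \<Gamma> (subst \<phi> x t) \<Longrightarrow> tyof t = Some (snd x) \<Longrightarrow> wff \<phi>
    \<Longrightarrow> derives T \<Gamma> (Exists x \<phi>)"
| ExistsE: "derives T \<Gamma> (Exists x \<phi>) \<Longrightarrow> derives T (insert (subst \<phi> x (V y)) \<Gamma>) \<psi> \<Longrightarrow> snd y = snd x
    \<Longrightarrow> y \<notin> (\<Union>\<chi>\<in>\<Gamma>. fv \<chi>) \<union> fv (Exists x \<phi>) \<union> fv \<psi> \<Longrightarrow> derives T \<Gamma> \<psi>"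

abbreviation proves :: "fm set \<Rightarrow> fm \<Rightarrow> bool" (infix "\<turnstile>" 45) where
  "T \<turnstile> \<phi> \<equiv> derives T {} \<phi>"


section \<open>The internal base theory\<close>

abbreviation tzero :: tm where "tzero \<equiv> C cZero"
abbreviation suc :: "tm \<Rightarrow> tm" where "suc t \<equiv> C cSucc \<cdot> t"
abbreviation tone :: tm where "tone \<equiv> suc tzero"
abbreviation mini :: "tm \<Rightarrow> tm \<Rightarrow> tm" where "mini s t \<equiv> C cMin \<cdot> s \<cdot> t"
abbreviation maxi :: "tm \<Rightarrow> tm \<Rightarrow> tm" where "maxi s t \<equiv> C cMax \<cdot> s \<cdot> t"
abbreviation tplus :: "tm \<Rightarrow> tm \<Rightarrow> tm" (infixl "\<^bold>+" 105) where "s \<^bold>+ t \<equiv> C cA1 \<cdot> s \<cdot> t"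
abbreviation ttimes :: "tm \<Rightarrow> tm \<Rightarrow> tm" (infixl "\<^bold>*" 110) where "s \<^bold>* t \<equiv> C cA2 \<cdot> s \<cdot> t"
abbreviation pow2 :: "tm \<Rightarrow> tm" where "pow2 t \<equiv> C cA3 \<cdot> suc tone \<cdot> t"
abbreviation Less :: "tm \<Rightarrow> tm \<Rightarrow> fm" where "Less s t \<equiv> Le (suc s) t"

text \<open>Equality at type \<open>\<rho>\<^sub>1 \<rightharpoonup> \<dots> \<rightharpoonup> \<rho>\<^sub>k \<rightharpoonup> N\<close> abbreviates equality of all values at type \<open>0\<close>.\<close>

primrec eqt :: "ty \<Rightarrow> tm \<Rightarrow> tm \<Rightarrow> fm" where
  "eqt N s t = Eq s t"
| "eqt (\<sigma> \<rightharpoonup> \<tau>) s t =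
    (let z = fresh \<sigma> (fvt s \<union> fvt t) in Forall z (eqt \<tau> (s \<cdot> V z) (t \<cdot> V z)))"

abbreviation vx :: "ty \<Rightarrow> tm" where "vx \<sigma> \<equiv> V (0, \<sigma>)"
abbreviation vy :: "ty \<Rightarrow> tm" where "vy \<sigma> \<equiv> V (1, \<sigma>)"
abbreviation vz :: "ty \<Rightarrow> tm" where "vz \<sigma> \<equiv> V (2, \<sigma>)"
abbreviation vu :: "ty \<Rightarrow> tm" where "vu \<sigma> \<equiv> V (3, \<sigma>)"
abbreviation vf :: tm where "vf \<equiv> V (0, N \<rightharpoonup> N)"
abbreviation vg :: tm where "vg \<equiv> V (0, N \<rightharpoonup> N \<rightharpoonup> N)"

definition argvars :: "ty \<Rightarrow> tm list" where
  "argvars \<rho> = map V (zip [4..<4 + length (targs \<rho>)] (targs \<rho>))"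

text \<open>The axioms of \<open>E-EFA\<^sup>\<omega> = E-G\<^sub>3A\<^sup>\<omega>\<close>. The bounding argument \<open>v\<close> of the recursor makes every
  value of the recursion, except the first, at most \<open>v x w\<close>.\<close>

inductive_set E_EFA :: "fm set" where
  eq_refl: "Eq (vx N) (vx N) \<in> E_EFA"
| eq_sym: "Eq (vx N) (vy N) \<^bold>\<longrightarrow> Eq (vy N) (vx N) \<in> E_EFA"
| eq_trans: "Eq (vx N) (vy N) \<^bold>\<and> Eq (vy N) (vz N) \<^bold>\<longrightarrow> Eq (vx N) (vz N) \<in> E_EFA"
| ext: "eqt \<rho> (vx \<rho>) (vy \<rho>) \<^bold>\<longrightarrow>
    eqt \<tau> (vz (\<rho> \<rightharpoonup> \<tau>) \<cdot> vx \<rho>) (vz (\<rho> \<rightharpoonup> \<tau>) \<cdot> vy \<rho>) \<in> E_EFA"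
| le_cong: "Eq (vx N) (vz N) \<^bold>\<and> Eq (vy N) (vu N) \<^bold>\<and> Le (vx N) (vy N) \<^bold>\<longrightarrow> Le (vz N) (vu N) \<in> E_EFA"
| le_zero: "Le (vx N) tzero \<^bold>\<longleftrightarrow> Eq (vx N) tzero \<in> E_EFA"
| le_suc: "Le (vx N) (suc (vy N)) \<^bold>\<longleftrightarrow> Le (vx N) (vy N) \<^bold>\<or> Eq (vx N) (suc (vy N)) \<in> E_EFA"
| suc_inj: "Eq (suc (vx N)) (suc (vy N)) \<^bold>\<longrightarrow> Eq (vx N) (vy N) \<in> E_EFA"
| suc_neq: "\<^bold>\<not> Eq (suc (vx N)) tzero \<in> E_EFA"
| min: "Le (mini (vx N) (vy N)) (vx N) \<^bold>\<and> Le (mini (vx N) (vy N)) (vy N) \<^bold>\<and>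
    (Eq (mini (vx N) (vy N)) (vx N) \<^bold>\<or> Eq (mini (vx N) (vy N)) (vy N)) \<in> E_EFA"
| max: "Le (vx N) (maxi (vx N) (vy N)) \<^bold>\<and> Le (vy N) (maxi (vx N) (vy N)) \<^bold>\<and>
    (Eq (maxi (vx N) (vy N)) (vx N) \<^bold>\<or> Eq (maxi (vx N) (vy N)) (vy N)) \<in> E_EFA"
| A0: "Eq (C cA0 \<cdot> vx N \<cdot> vy N) (suc (vy N)) \<in> E_EFA"
| A1_0: "Eq (C cA1 \<cdot> vx N \<cdot> tzero) (vx N) \<in> E_EFA"
| A1_S: "Eq (C cA1 \<cdot> vx N \<cdot> suc (vy N)) (C cA0 \<cdot> vx N \<cdot> (C cA1 \<cdot> vx N \<cdot> vy N)) \<in> E_EFA"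
| A2_0: "Eq (C cA2 \<cdot> vx N \<cdot> tzero) tzero \<in> E_EFA"
| A2_S: "Eq (C cA2 \<cdot> vx N \<cdot> suc (vy N)) (C cA1 \<cdot> vx N \<cdot> (C cA2 \<cdot> vx N \<cdot> vy N)) \<in> E_EFA"
| A3_0: "Eq (C cA3 \<cdot> vx N \<cdot> tzero) tone \<in> E_EFA"
| A3_S: "Eq (C cA3 \<cdot> vx N \<cdot> suc (vy N)) (C cA2 \<cdot> vx N \<cdot> (C cA3 \<cdot> vx N \<cdot> vy N)) \<in> E_EFA"
| Phi1_0: "Eq (C cPhi1 \<cdot> vf \<cdot> tzero) (vf \<cdot> tzero) \<in> E_EFA"
| Phi1_S: "Eq (C cPhi1 \<cdot> vf \<cdot> suc (vx N)) (maxi (vf \<cdot> suc (vx N)) (C cPhi1 \<cdot> vf \<cdot> vx N)) \<in> E_EFA"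
| Phi2_0: "Eq (C cPhi2 \<cdot> vf \<cdot> tzero) (vf \<cdot> tzero) \<in> E_EFA"
| Phi2_S: "Eq (C cPhi2 \<cdot> vf \<cdot> suc (vx N))
    (C cA1 \<cdot> (vf \<cdot> suc (vx N)) \<cdot> (C cPhi2 \<cdot> vf \<cdot> vx N)) \<in> E_EFA"
| Phi3_0: "Eq (C cPhi3 \<cdot> vf \<cdot> tzero) (vf \<cdot> tzero) \<in> E_EFA"
| Phi3_S: "Eq (C cPhi3 \<cdot> vf \<cdot> suc (vx N))
    (C cA2 \<cdot> (vf \<cdot> suc (vx N)) \<cdot> (C cPhi3 \<cdot> vf \<cdot> vx N)) \<in> E_EFA"
| mu_hit: "Le (vy N) (vx N) \<^bold>\<and> Eq (vg \<cdot> vx N \<cdot> vy N) tzero \<^bold>\<longrightarrow>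
    Eq (vg \<cdot> vx N \<cdot> (C cMu \<cdot> vg \<cdot> vx N)) tzero \<in> E_EFA"
| mu_least: "Less (vy N) (C cMu \<cdot> vg \<cdot> vx N) \<^bold>\<longrightarrow> \<^bold>\<not> Eq (vg \<cdot> vx N \<cdot> vy N) tzero \<in> E_EFA"
| mu_default: "Eq (C cMu \<cdot> vg \<cdot> vx N) tzero \<^bold>\<or>
    Eq (vg \<cdot> vx N \<cdot> (C cMu \<cdot> vg \<cdot> vx N)) tzero \<^bold>\<and> Le (C cMu \<cdot> vg \<cdot> vx N) (vx N) \<in> E_EFA"
| Pi: "eqt \<rho> (C (cPi \<rho> \<tau>) \<cdot> vx \<rho> \<cdot> vy \<tau>) (vx \<rho>) \<in> E_EFA"
| Sig: "eqt \<tau>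
    (C (cSig \<delta> \<rho> \<tau>) \<cdot> vx (\<delta> \<rightharpoonup> \<rho> \<rightharpoonup> \<tau>) \<cdot> vy (\<delta> \<rightharpoonup> \<rho>) \<cdot> vz \<delta>)
    (vx (\<delta> \<rightharpoonup> \<rho> \<rightharpoonup> \<tau>) \<cdot> vz \<delta> \<cdot> (vy (\<delta> \<rightharpoonup> \<rho>) \<cdot> vz \<delta>)) \<in> E_EFA"
| R_0: "y = vy \<rho> \<Longrightarrow> z = vz (N \<rightharpoonup> N \<rightharpoonup> \<rho>) \<Longrightarrow> v = vu (N \<rightharpoonup> \<rho>) \<Longrightarrow> w = argvars \<rho> \<Longrightarrow>
    Eq (apps (C (cR \<rho>) \<cdot> tzero \<cdot> y \<cdot> z \<cdot> v) w) (apps y w) \<in> E_EFA"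
| R_S: "x = vx N \<Longrightarrow> y = vy \<rho> \<Longrightarrow> z = vz (N \<rightharpoonup> N \<rightharpoonup> \<rho>) \<Longrightarrow> v = vu (N \<rightharpoonup> \<rho>) \<Longrightarrow> w = argvars \<rho> \<Longrightarrow>
    Eq (apps (C (cR \<rho>) \<cdot> suc x \<cdot> y \<cdot> z \<cdot> v) w)
       (mini (apps (z \<cdot> apps (C (cR \<rho>) \<cdot> x \<cdot> y \<cdot> z \<cdot> v) w \<cdot> x) w) (apps (v \<cdot> x) w)) \<in> E_EFA"
| QF_IA: "wff A \<Longrightarrow> qf A \<Longrightarrow> snd x = N \<Longrightarrow>
    subst A x tzero \<^bold>\<and> Forall x (A \<^bold>\<longrightarrow> subst A x (suc (V x))) \<^bold>\<longrightarrow> Forall x A \<in> E_EFA"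


section \<open>Closed terms for sequence coding\<close>

text \<open>Lambda abstraction by the usual combinator translation.\<close>

primrec lam :: "var \<Rightarrow> tm \<Rightarrow> tm" where
  "lam x (V y) = (let \<sigma> = snd x in
     if y = x then C (cSig \<sigma> (\<sigma> \<rightharpoonup> \<sigma>) \<sigma>) \<cdot> C (cPi \<sigma> (\<sigma> \<rightharpoonup> \<sigma>)) \<cdot> C (cPi \<sigma> \<sigma>)
     else C (cPi (snd y) \<sigma>) \<cdot> V y)"
| "lam x (C c) = C (cPi (cty c) (snd x)) \<cdot> C c"
| "lam x (s \<cdot> t) = (let \<sigma> = snd x; \<rho> = the (tyof t); \<tau> = the (tyof (s \<cdot> t)) in
     if x \<in> fvt (s \<cdot> t) then C (cSig \<sigma> \<rho> \<tau>) \<cdot> lam x s \<cdot> lam x t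
     else C (cPi \<tau> \<sigma>) \<cdot> (s \<cdot> t))"

abbreviation nn :: var where "nn \<equiv> (0, N)"
abbreviation kk :: var where "kk \<equiv> (1, N)"
abbreviation rr :: var where "rr \<equiv> (2, N)"
abbreviation ii :: var where "ii \<equiv> (3, N)"
abbreviation aa :: var where "aa \<equiv> (4, N)"
abbreviation jj :: var where "jj \<equiv> (5, N)"

text \<open>\<open>brec t s u v\<close> is the value at \<open>t\<close> of the recursion with initial value \<open>s\<close>, step
  \<open>\<lambda>r k. u\<close> and bound \<open>\<lambda>k. v\<close> for the value at \<open>k + 1\<close>. In all uses below the bound is never
  exceeded.\<close>

definition brec :: "tm \<Rightarrow> tm \<Rightarrow> tm \<Rightarrow> tm \<Rightarrow> tm" where
  "brec t s u v = C (cR N) \<cdot> t \<cdot> s \<cdot> lam rr (lam kk u) \<cdot> lam kk v"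

definition pred_tm :: tm where
  "pred_tm = lam nn (brec (V nn) tzero (V kk) (V kk))"

definition monus_tm :: tm where
  "monus_tm = lam nn (lam ii (brec (V ii) (V nn) (pred_tm \<cdot> V rr) (V nn)))"

abbreviation monus :: "tm \<Rightarrow> tm \<Rightarrow> tm" where "monus s t \<equiv> monus_tm \<cdot> s \<cdot> t"

text \<open>Characteristic terms with values \<open>0\<close> (false) and \<open>1\<close> (true), of \<open>t = 0\<close>, \<open>s < t\<close>
  and \<open>s = t\<close>.\<close>

definition isz :: "tm \<Rightarrow> tm" where "isz t = monus tone t"
definition ltc :: "tm \<Rightarrow> tm \<Rightarrow> tm" where "ltc s t = isz (isz (monus t s))"
definition eqc :: "tm \<Rightarrow> tm \<Rightarrow> tm" where "eqc s t = isz (monus s t \<^bold>+ monus t s)"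

definition mod2_tm :: tm where
  "mod2_tm = lam nn (brec (V nn) tzero (isz (V rr)) tone)"

definition half_tm :: tm where
  "half_tm = lam nn (brec (V nn) tzero (V rr \<^bold>+ mod2_tm \<cdot> V kk) (suc (V kk)))"

definition shift_tm :: tm where
  "shift_tm = lam nn (lam ii (brec (V ii) (V nn) (half_tm \<cdot> V rr) (V nn)))"

definition bit_tm :: tm where
  "bit_tm = lam nn (lam ii (mod2_tm \<cdot> (shift_tm \<cdot> V nn \<cdot> V ii)))"

definition ones_tm :: tm where
  "ones_tm = lam nn (lam ii (brec (V ii) tzero (V rr \<^bold>+ bit_tm \<cdot> V nn \<cdot> V kk) (suc (V kk))))"

text \<open>The number \<open>2\<^bsup>p\<^sub>0\<^esup> + \<dots> + 2\<^bsup>p\<^sub>l\<^sub>-\<^sub>1\<^esup>\<close> with \<open>p\<^sub>0 < \<dots> < p\<^sub>l\<^sub>-\<^sub>1\<close> codes the sequence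
  \<open>p\<^sub>0, p\<^sub>1 - p\<^sub>0 - 1, p\<^sub>2 - p\<^sub>1 - 1, \<dots>\<close> of length \<open>l\<close>: in binary, starting from the least significant
  digit, the component \<open>x\<close> is written as \<open>x\<close> zeros followed by a one. This is a bijection between
  numbers and finite sequences of numbers. Component \<open>i\<close> is the number of zeros preceded by
  exactly \<open>i\<close> ones, and is \<open>0\<close> by convention if \<open>i\<close> is not less than the length.\<close>

definition lh0_tm :: tm where
  "lh0_tm = lam nn (ones_tm \<cdot> V nn \<cdot> V nn)"

definition comp0_tm :: tm where
  "comp0_tm = lam nn (lam ii (ltc (V ii) (lh0_tm \<cdot> V nn) \<^bold>*
     brec (V nn) tzero
       (V rr \<^bold>+ isz (bit_tm \<cdot> V nn \<cdot> V kk) \<^bold>* eqc (ones_tm \<cdot> V nn \<cdot> V kk) (V ii))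
       (suc (V kk))))"

text \<open>Number of binary digits.\<close>

definition blen_tm :: tm where
  "blen_tm = lam nn (brec (V nn) tzero
     (V rr \<^bold>+ isz (isz (shift_tm \<cdot> V nn \<cdot> V kk))) (suc (V kk)))"

text \<open>Concatenation of codes of sequences of numbers.\<close>

definition cat0_tm :: tm where
  "cat0_tm = lam nn (lam ii (V nn \<^bold>+ pow2 (blen_tm \<cdot> V nn) \<^bold>* V ii))"

text \<open>\<open>bar_tm \<cdot> g \<cdot> m\<close> is the code of the initial segment \<open>g 0, \<dots>, g (m - 1)\<close>.\<close>

definition bar_tm :: tm where
  "bar_tm = (let g = (0, N \<rightharpoonup> N) in lam g (lam nn (brec (V nn) tzero
     (cat0_tm \<cdot> V rr \<cdot> pow2 (V g \<cdot> V kk))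
     (pow2 (C cPhi2 \<cdot> lam ii (suc (V g \<cdot> V ii)) \<cdot> V kk)))))"

text \<open>An object \<open>y\<close> of type \<open>\<sigma>\<close> codes the sequence whose length is that of the number
  \<open>y 0 \<dots> 0\<close> and whose component \<open>i\<close> is obtained pointwise, as the function taking arguments
  \<open>z\<close> to component \<open>i\<close> of the number \<open>y z\<close>.\<close>

primrec zero_tm :: "ty \<Rightarrow> tm" where
  "zero_tm N = tzero"
| "zero_tm (\<sigma> \<rightharpoonup> \<tau>) = lam (0, \<sigma>) (zero_tm \<tau>)"

primrec lh_tm :: "ty \<Rightarrow> tm" where
  "lh_tm N = lh0_tm"
| "lh_tm (\<sigma> \<rightharpoonup> \<tau>) = (let y = (0, \<sigma> \<rightharpoonup> \<tau>) in lam y (lh_tm \<tau> \<cdot> (V y \<cdot> zero_tm \<sigma>)))"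

primrec comp_tm :: "ty \<Rightarrow> tm" where
  "comp_tm N = comp0_tm"
| "comp_tm (\<sigma> \<rightharpoonup> \<tau>) = (let y = (0, \<sigma> \<rightharpoonup> \<tau>); z = (1, \<sigma>) in
     lam y (lam ii (lam z (comp_tm \<tau> \<cdot> (V y \<cdot> V z) \<cdot> V ii))))"

text \<open>\<open>mem \<sigma> x y\<close> is \<open>x \<in> y\<close>: some component of \<open>y\<close> equals \<open>x\<close>.\<close>

definition mem :: "ty \<Rightarrow> tm \<Rightarrow> tm \<Rightarrow> fm" where
  "mem \<sigma> x y = (let m = fresh N (fvt x \<union> fvt y) in
     Exists m (Less (V m) (lh_tm \<sigma> \<cdot> y) \<^bold>\<and> eqt \<sigma> x (comp_tm \<sigma> \<cdot> y \<cdot> V m)))"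

text \<open>\<open>flat_tm \<sigma> \<cdot> W \<cdot> L \<cdot> m\<close> codes the concatenation of the sequences coded by \<open>W 0, \<dots>, W (m - 1)\<close>
  of type \<open>\<sigma>\<close>, whose lengths are \<open>L 0, \<dots>, L (m - 1)\<close>. The inner \<open>bar_tm\<close> brings the number
  \<open>W k z\<close> to the length \<open>L k\<close>, since its own length may depend on \<open>z\<close>.\<close>

primrec flat_tm :: "ty \<Rightarrow> tm" where
  "flat_tm N = (let W = (0, N \<rightharpoonup> N); L = (1, N \<rightharpoonup> N);
       block = (\<lambda>t. bar_tm \<cdot> (comp0_tm \<cdot> (V W \<cdot> t)) \<cdot> (V L \<cdot> t)) in
     lam W (lam L (lam nn (brec (V nn) tzero
       (cat0_tm \<cdot> V rr \<cdot> block (V kk))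
       (pow2 (C cPhi2 \<cdot> lam ii (blen_tm \<cdot> block (V ii)) \<cdot> V kk))))))"
| "flat_tm (\<sigma> \<rightharpoonup> \<tau>) = (let W = (0, N \<rightharpoonup> \<sigma> \<rightharpoonup> \<tau>); L = (1, N \<rightharpoonup> N); z = (6, \<sigma>) in
     lam W (lam L (lam nn (lam z (flat_tm \<tau> \<cdot> lam kk (V W \<cdot> V kk \<cdot> V z) \<cdot> V L \<cdot> V nn)))))"

text \<open>\<open>Y[x]\<close>, the concatenation of the sequences \<open>f(x)\<close> for the components \<open>f\<close> of \<open>Y\<close>.\<close>

definition img_tm :: "ty \<Rightarrow> ty \<Rightarrow> tm" where
  "img_tm \<sigma> \<tau> = (let Y = (0, \<sigma> \<rightharpoonup> \<tau>); x = (6, \<sigma>);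
       val = comp_tm (\<sigma> \<rightharpoonup> \<tau>) \<cdot> V Y \<cdot> V kk \<cdot> V x in
     lam Y (lam x (flat_tm \<tau> \<cdot> lam kk val \<cdot> lam kk (lh_tm \<tau> \<cdot> val) \<cdot> (lh_tm (\<sigma> \<rightharpoonup> \<tau>) \<cdot> V Y))))"


section \<open>The nonstandard theory\<close>

inductive_set ST :: "fm set" where
  EQ_all: "wff \<Phi> \<Longrightarrow> ForallSt x \<Phi> \<^bold>\<longleftrightarrow> Forall x (St (snd x) (V x) \<^bold>\<longrightarrow> \<Phi>) \<in> ST"
| EQ_ex: "wff \<Phi> \<Longrightarrow> ExistsSt x \<Phi> \<^bold>\<longleftrightarrow> Exists x (St (snd x) (V x) \<^bold>\<and> \<Phi>) \<in> ST"
| st_eq: "St \<sigma> (vx \<sigma>) \<^bold>\<and> eqt \<sigma> (vx \<sigma>) (vy \<sigma>) \<^bold>\<longrightarrow> St \<sigma> (vy \<sigma>) \<in> ST"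
| st_closed: "tyof t = Some \<sigma> \<Longrightarrow> fvt t = {} \<Longrightarrow> St \<sigma> t \<in> ST"
| st_app: "St (\<sigma> \<rightharpoonup> \<tau>) (vx (\<sigma> \<rightharpoonup> \<tau>)) \<^bold>\<and> St \<sigma> (vy \<sigma>) \<^bold>\<longrightarrow>
    St \<tau> (vx (\<sigma> \<rightharpoonup> \<tau>) \<cdot> vy \<sigma>) \<in> ST"
| st_le: "St N (vx N) \<^bold>\<and> Le (vy N) (vx N) \<^bold>\<longrightarrow> St N (vy N) \<in> ST"

inductive_set Idealization :: "fm set" where
  "wff \<phi> \<Longrightarrow> internal \<phi> \<Longrightarrow> x \<noteq> y \<Longrightarrow> y' \<notin> fv \<phi> \<union> {x, y} \<Longrightarrow> snd y' = snd y \<Longrightarrow>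
    ForallSt y' (Exists x (Forall y (mem (snd y) (V y) (V y') \<^bold>\<longrightarrow> \<phi>))) \<^bold>\<longrightarrow>
    Exists x (ForallSt y \<phi>) \<in> Idealization"

inductive_set HAC_int :: "fm set" where
  "wff \<phi> \<Longrightarrow> internal \<phi> \<Longrightarrow> x \<noteq> y \<Longrightarrow> Y \<notin> fv \<phi> \<union> {x, y} \<Longrightarrow> snd Y = snd x \<rightharpoonup> snd y \<Longrightarrow>
    ForallSt x (ExistsSt y \<phi>) \<^bold>\<longrightarrow>
    ExistsSt Y (ForallSt x (Exists y
      (mem (snd y) (V y) (img_tm (snd x) (snd y) \<cdot> V Y \<cdot> V x) \<^bold>\<and> \<phi>))) \<in> HAC_int"

inductive_set PF_TP :: "fm set" where
  "wff \<phi> \<Longrightarrow> internal \<phi> \<Longrightarrow> fv \<phi> \<subseteq> set xs \<Longrightarrow>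
    foldr ForallSt xs \<phi> \<^bold>\<longrightarrow> foldr Forall xs \<phi> \<in> PF_TP"

text \<open>\<open>QF_AC p q\<close> for tuples \<open>xs\<close> of variables of type level \<open>p\<close> and \<open>ys\<close> of type level \<open>q\<close>; the
  variables \<open>Ys\<close> are the choice functions, one for each element of \<open>ys\<close>.\<close>

inductive_set QF_AC :: "nat \<Rightarrow> nat \<Rightarrow> fm set" for p q where
  "wff A \<Longrightarrow> qf A \<Longrightarrow> distinct (xs @ ys @ Ys) \<Longrightarrow> set Ys \<inter> fv A = {} \<Longrightarrow>
    (\<forall>x \<in> set xs. ty_level (snd x) = p) \<Longrightarrow> (\<forall>y \<in> set ys. ty_level (snd y) = q) \<Longrightarrow>
    map snd Ys = map (\<lambda>y. foldr Arr (map snd xs) (snd y)) ys \<Longrightarrow>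
    \<theta> = (\<lambda>v. case map_of (zip ys Ys) v of Some Y \<Rightarrow> apps (V Y) (map V xs) | None \<Rightarrow> V v) \<Longrightarrow>
    foldr Forall xs (foldr Exists ys A) \<^bold>\<longrightarrow>
    foldr Exists Ys (foldr Forall xs (psubst A \<theta>)) \<in> QF_AC p q"

definition B0 :: "fm set" where
  "B0 = E_EFA \<union> ST \<union> Idealization \<union> HAC_int \<union> PF_TP \<union> QF_AC 1 0"

definition exists2 :: fm where
  "exists2 = (let \<phi> = (0, (N \<rightharpoonup> N) \<rightharpoonup> N); f = (0, N \<rightharpoonup> N); x = (0, N) in
     Exists \<phi> (Forall f (Eq (V \<phi> \<cdot> V f) tzero \<^bold>\<longleftrightarrow> Exists x (Eq (V f \<cdot> V x) tzero))))"


section \<open>Arithmetical transfinite recursion\<close>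

text \<open>A type \<open>1\<close> object \<open>Z\<close> represents the set of all \<open>x\<close> with \<open>Z x = 1\<close>. Pairs of numbers are
  coded as in Simpson's book.\<close>

definition inset :: "tm \<Rightarrow> tm \<Rightarrow> fm" where "inset x Z = Eq (Z \<cdot> x) tone"

definition pair :: "tm \<Rightarrow> tm \<Rightarrow> tm" where "pair s t = (s \<^bold>+ t) \<^bold>* (s \<^bold>+ t) \<^bold>+ s"

definition leX :: "tm \<Rightarrow> tm \<Rightarrow> tm \<Rightarrow> fm" where "leX X s t = inset (pair s t) X"
definition lessX :: "tm \<Rightarrow> tm \<Rightarrow> tm \<Rightarrow> fm" where "lessX X s t = leX X s t \<^bold>\<and> \<^bold>\<not> leX X t s"
definition fieldX :: "tm \<Rightarrow> tm \<Rightarrow> fm" where "fieldX X s = leX X s s"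

abbreviation vX :: var where "vX \<equiv> (0, N \<rightharpoonup> N)"
abbreviation vF :: var where "vF \<equiv> (1, N \<rightharpoonup> N)"
abbreviation vY :: var where "vY \<equiv> (2, N \<rightharpoonup> N)"
abbreviation vG :: var where "vG \<equiv> (3, N \<rightharpoonup> N)"

definition LO :: fm where
  "LO = (let le = (\<lambda>s t. leX (V vX) (V s) (V t)); fld = (\<lambda>s. fieldX (V vX) (V s)) in
     Forall ii (Forall jj (le ii jj \<^bold>\<longrightarrow> fld ii \<^bold>\<and> fld jj)) \<^bold>\<and>
     Forall ii (Forall jj (Forall kk (le ii jj \<^bold>\<and> le jj kk \<^bold>\<longrightarrow> le ii kk))) \<^bold>\<and>
     Forall ii (Forall jj (le ii jj \<^bold>\<and> le jj ii \<^bold>\<longrightarrow> Eq (V ii) (V jj))) \<^bold>\<and>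
     Forall ii (Forall jj (fld ii \<^bold>\<and> fld jj \<^bold>\<longrightarrow> le ii jj \<^bold>\<or> le jj ii)))"

definition WO :: fm where
  "WO = LO \<^bold>\<and> \<^bold>\<not> Exists vG (Forall nn (lessX (V vX) (V vG \<cdot> suc (V nn)) (V vG \<cdot> V nn)))"

text \<open>\<open>cut_tm \<cdot> X \<cdot> Y \<cdot> j\<close> is the characteristic function of the set \<open>Y\<^sup>j\<close> of all pairs \<open>(a, i)\<close> in
  \<open>Y\<close> with \<open>i <\<^sub>X j\<close>; at most one summand below is nonzero, because \<open>pair\<close> is injective.\<close>

definition cut_tm :: tm where
  "cut_tm = lam vX (lam vY (lam jj (lam kk
     (C cPhi2 \<cdot> lam ii (C cPhi2 \<cdot> lam aa
         (eqc (V kk) (pair (V aa) (V ii)) \<^bold>*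
          (eqc (V vX \<cdot> pair (V ii) (V jj)) tone \<^bold>* isz (eqc (V vX \<cdot> pair (V jj) (V ii)) tone)) \<^bold>*
          eqc (V vY \<cdot> V kk) tone)
       \<cdot> V kk) \<cdot> V kk))))"

text \<open>The formula \<open>\<theta>(n, Y\<^sup>j)\<close>, where \<open>f(m, n, s)\<close> is \<open>f\<close> applied to the code of the triple.\<close>

definition theta :: fm where
  "theta = (let m = rr in Exists m
     (Eq (V vF \<cdot> pair (V m) (pair (V nn) (bar_tm \<cdot> (cut_tm \<cdot> V vX \<cdot> V vY \<cdot> V jj) \<cdot> V m))) tzero))"

definition H :: fm where
  "H = Forall kk (inset (V kk) (V vY) \<^bold>\<longleftrightarrow>
     Exists nn (Le (V nn) (V kk) \<^bold>\<and> Exists jj (Le (V jj) (V kk) \<^bold>\<and>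
       Eq (V kk) (pair (V nn) (V jj)) \<^bold>\<and> fieldX (V vX) (V jj) \<^bold>\<and> theta)))"

definition ATR :: fm where
  "ATR = Forall vX (Forall vF (WO \<^bold>\<longrightarrow> Exists vY H))"

text \<open>Relativisation to \<open>st\<close> of all quantifiers except bounded number quantifiers.\<close>

definition bounded_by :: "var \<Rightarrow> fm \<Rightarrow> bool" where
  "bounded_by x \<phi> \<longleftrightarrow> (\<exists>t. x \<notin> fvt t \<and> (\<phi> = Le (V x) t \<or> \<phi> = Less (V x) t))"

primrec relst :: "fm \<Rightarrow> fm" where
  "relst (Eq s t) = Eq s t"
| "relst (Le s t) = Le s t"
| "relst (St \<sigma> t) = St \<sigma> t"
| "relst Bot = Bot"
| "relst (\<phi> \<^bold>\<longrightarrow> \<psi>) = relst \<phi> \<^bold>\<longrightarrow> relst \<psi>"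
| "relst (\<phi> \<^bold>\<and> \<psi>) = relst \<phi> \<^bold>\<and> relst \<psi>"
| "relst (\<phi> \<^bold>\<or> \<psi>) = relst \<phi> \<^bold>\<or> relst \<psi>"
| "relst (Forall x \<phi>) =
    (if \<exists>\<beta> \<psi>. \<phi> = \<beta> \<^bold>\<longrightarrow> \<psi> \<and> bounded_by x \<beta> then Forall x (relst \<phi>) else ForallSt x (relst \<phi>))"
| "relst (Exists x \<phi>) =
    (if \<exists>\<beta> \<psi>. \<phi> = \<beta> \<^bold>\<and> \<psi> \<and> bounded_by x \<beta> then Exists x (relst \<phi>) else ExistsSt x (relst \<phi>))"
| "relst (ForallSt x \<phi>) = ForallSt x (relst \<phi>)"
| "relst (ExistsSt x \<phi>) = ExistsSt x (relst \<phi>)"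

end

theory Submission
  imports Defs "HOL-Library.Countable"
begin

text \<open>The argument is model-theoretic. For theories containing the axioms (EQ) the deduction system is
  complete (\<open>completeness\<close>): a well-formed formula that holds in every typed structure satisfying the
  axioms is derivable. It is therefore enough to compare \<open>ATR\<close> with its relativisation inside an arbitrary model.

  \<^bold>\<open>Standard witnesses.\<close> By \<open>(\<exists>\<^sup>2)\<close> and \<open>QF-AC\<^sup>1\<^sup>,\<^sup>0\<close> there is a functional \<open>\<mu>\<close> that finds a zero
  of every type \<open>1\<close> function having one. Its existence is an internal statement without parameters, so
  the contrapositive of \<open>PF-TP\<close> provides a standard \<open>\<mu>\<close>. Standard objects are closed under
  application; hence a standard \<open>f\<close> with a zero has the standard zero \<open>\<mu> f\<close>. Every arithmetical
  formula is equivalent to an equation \<open>t = 0\<close> with \<open>t\<close> built from \<open>\<mu>\<close> and a functional for the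
  propositional connectives (\<open>char_tm_zero\<close>). Consequently an arithmetical formula with standard
  parameters is equivalent to its relativisation (\<open>transfer\<close>).

  \<^bold>\<open>Well-orderings.\<close> What remains is that \<open>WO\<close> is not arithmetical: a standard linear order might
  have descending sequences, all of them nonstandard. This is avoided by rewriting \<open>ATR\<close> as
  \<open>\<forall>X, f. \<exists>Y, g. LO(X) \<longrightarrow> H\<^sub>f(X, Y) \<or> g descends in X\<close>, whose matrix is arithmetical. If this holds,
  then \<open>QF-AC\<^sup>1\<^sup>,\<^sup>1\<close> applied to the equivalent equation yields functionals producing \<open>Y\<close> and \<open>g\<close>, and
  by \<open>PF-TP\<close> standard ones (\<open>witness_functionals\<close>). For standard \<open>X\<close> and \<open>f\<close> the resulting \<open>Y\<close>
  and \<open>g\<close> are standard, so if \<open>X\<close> has no standard descending sequence, \<open>Y\<close> is the iteration that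
  \<open>ATR\<^sup>s\<^sup>t\<close> demands. Conversely, \<open>ATR\<^sup>s\<^sup>t\<close> gives \<open>\<exists>Y, g\<close> for all standard \<open>X, f\<close>; this
  statement has no other parameters, so \<open>PF-TP\<close> extends it to all \<open>X, f\<close>.\<close>

section \<open>Structures and the substitution lemma\<close>

text \<open>Equality of type \<open>0\<close> is interpreted by an arbitrary relation, because the deduction system treats it
  as an ordinary predicate governed by axioms.\<close>

record 'd struct =
  Dom :: "ty \<Rightarrow> 'd set"
  Con :: "cst \<Rightarrow> 'd"
  Ap :: "'d \<Rightarrow> 'd \<Rightarrow> 'd"
  EqR :: "'d \<Rightarrow> 'd \<Rightarrow> bool"
  LeR :: "'d \<Rightarrow> 'd \<Rightarrow> bool"
  StR :: "ty \<Rightarrow> 'd \<Rightarrow> bool"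

primrec ev :: "('d, 'm) struct_scheme \<Rightarrow> tm \<Rightarrow> (var \<Rightarrow> 'd) \<Rightarrow> 'd" where
  "ev M (V x) e = e x"
| "ev M (C c) e = Con M c"
| "ev M (s \<cdot> t) e = Ap M (ev M s e) (ev M t e)"

text \<open>The standard quantifiers are read as bounded by \<open>St\<close>. The deduction system itself has no rules for
  them, so this reading is adequate only for theories containing the axioms (EQ).\<close>

primrec sem :: "('d, 'm) struct_scheme \<Rightarrow> fm \<Rightarrow> (var \<Rightarrow> 'd) \<Rightarrow> bool" where
  "sem M (Eq s t) e = EqR M (ev M s e) (ev M t e)"
| "sem M (Le s t) e = LeR M (ev M s e) (ev M t e)"
| "sem M (St \<sigma> t) e = StR M \<sigma> (ev M t e)"
| "sem M Bot e = False"
| "sem M (\<phi> \<^bold>\<longrightarrow> \<psi>) e = (sem M \<phi> e \<longrightarrow> sem M \<psi> e)"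
| "sem M (\<phi> \<^bold>\<and> \<psi>) e = (sem M \<phi> e \<and> sem M \<psi> e)"
| "sem M (\<phi> \<^bold>\<or> \<psi>) e = (sem M \<phi> e \<or> sem M \<psi> e)"
| "sem M (Forall x \<phi>) e = (\<forall>d \<in> Dom M (snd x). sem M \<phi> (e(x := d)))"
| "sem M (Exists x \<phi>) e = (\<exists>d \<in> Dom M (snd x). sem M \<phi> (e(x := d)))"
| "sem M (ForallSt x \<phi>) e =
    (\<forall>d \<in> Dom M (snd x). StR M (snd x) d \<longrightarrow> sem M \<phi> (e(x := d)))"
| "sem M (ExistsSt x \<phi>) e =
    (\<exists>d \<in> Dom M (snd x). StR M (snd x) d \<and> sem M \<phi> (e(x := d)))"

definition typed_struct :: "('d, 'm) struct_scheme \<Rightarrow> bool" where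
  "typed_struct M \<longleftrightarrow> (\<forall>c. Con M c \<in> Dom M (cty c)) \<and>
     (\<forall>\<sigma> \<tau>. \<forall>a \<in> Dom M (\<sigma> \<rightharpoonup> \<tau>). \<forall>b \<in> Dom M \<sigma>. Ap M a b \<in> Dom M \<tau>)"

definition typed_env :: "('d, 'm) struct_scheme \<Rightarrow> (var \<Rightarrow> 'd) \<Rightarrow> bool" where
  "typed_env M e \<longleftrightarrow> (\<forall>x. e x \<in> Dom M (snd x))"

definition valid :: "('d, 'm) struct_scheme \<Rightarrow> fm \<Rightarrow> bool" where
  "valid M \<phi> \<longleftrightarrow> (\<forall>e. typed_env M e \<longrightarrow> sem M \<phi> e)"

lemma finite_fvt: "finite (fvt t)"
  by (induction t) auto

lemma finite_fv: "finite (fv \<phi>)"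
  by (induction \<phi>) (auto simp: finite_fvt)

lemma fresh_notin: "finite A \<Longrightarrow> fresh \<sigma> A \<notin> A"
proof -
  assume "finite A"
  then have "finite ((\<lambda>n. (n, \<sigma>)) -` A)"
    by (rule finite_vimageI) (auto simp: inj_def)
  then obtain n where "n \<notin> (\<lambda>n. (n, \<sigma>)) -` A"
    using ex_new_if_finite infinite_UNIV_nat by blast
  then have "(n, \<sigma>) \<notin> A" by simp
  then show ?thesis unfolding fresh_def by (rule LeastI)
qed

lemma snd_fresh [simp]: "snd (fresh \<sigma> A) = \<sigma>"
  by (simp add: fresh_def)

lemma snd_bvar [simp]: "snd (bvar \<theta> x \<phi>) = snd x"
  by (simp add: bvar_def Let_def)

text \<open>The renamed bound variable cannot be captured: this is the only property of \<open>bvar\<close> on which the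
  substitution lemma rests.\<close>

lemma bvar_notin: "z \<in> fv \<phi> - {x} \<Longrightarrow> bvar \<theta> x \<phi> \<notin> fvt (\<theta> z)"
proof -
  assume z: "z \<in> fv \<phi> - {x}"
  let ?A = "\<Union>z \<in> fv \<phi> - {x}. fvt (\<theta> z)"
  have "finite ?A" by (simp add: finite_fv finite_fvt)
  then have "bvar \<theta> x \<phi> \<notin> ?A"
    using fresh_notin[of ?A "snd x"] by (auto simp: bvar_def Let_def)
  with z show ?thesis by blast
qed

lemma ev_cong: "(\<And>x. x \<in> fvt t \<Longrightarrow> e x = e' x) \<Longrightarrow> ev M t e = ev M t e'"
  by (induction t) auto

lemma ev_update_fresh [simp]: "x \<notin> fvt t \<Longrightarrow> ev M t (e(x := d)) = ev M t e"
  by (rule ev_cong) auto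

lemma sem_cong: "(\<And>x. x \<in> fv \<phi> \<Longrightarrow> e x = e' x) \<Longrightarrow> sem M \<phi> e = sem M \<phi> e'"
proof (induction \<phi> arbitrary: e e')
  case (Eq s t)
  then show ?case using ev_cong[of s e e' M] ev_cong[of t e e' M] by simp
next
  case (Le s t)
  then show ?case using ev_cong[of s e e' M] ev_cong[of t e e' M] by simp
next
  case (St \<sigma> t)
  then show ?case using ev_cong[of t e e' M] by simp
next
  case (Imp \<phi> \<psi>)
  show ?case using Imp.IH[of e e'] Imp.prems by simp
next
  case (Conj \<phi> \<psi>)
  show ?case using Conj.IH[of e e'] Conj.prems by simp
next
  case (Disj \<phi> \<psi>)
  show ?case using Disj.IH[of e e'] Disj.prems by simp
next
  case (Forall x \<phi>)
  have "sem M \<phi> (e(x := d)) = sem M \<phi> (e'(x := d))" for d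
    by (rule Forall.IH) (use Forall.prems in auto)
  then show ?case by simp
next
  case (Exists x \<phi>)
  have "sem M \<phi> (e(x := d)) = sem M \<phi> (e'(x := d))" for d
    by (rule Exists.IH) (use Exists.prems in auto)
  then show ?case by simp
next
  case (ForallSt x \<phi>)
  have "sem M \<phi> (e(x := d)) = sem M \<phi> (e'(x := d))" for d
    by (rule ForallSt.IH) (use ForallSt.prems in auto)
  then show ?case by simp
next
  case (ExistsSt x \<phi>)
  have "sem M \<phi> (e(x := d)) = sem M \<phi> (e'(x := d))" for d
    by (rule ExistsSt.IH) (use ExistsSt.prems in auto)
  then show ?case by simp
qed auto

lemma ev_tsubst: "ev M (tsubst t \<theta>) e = ev M t (\<lambda>x. ev M (\<theta> x) e)"
  by (induction t) auto

lemma sem_bvar: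
  "sem M \<phi> (\<lambda>z. ev M ((\<theta>(x := V (bvar \<theta> x \<phi>))) z) (e(bvar \<theta> x \<phi> := d))) =
   sem M \<phi> ((\<lambda>z. ev M (\<theta> z) e)(x := d))"
proof (rule sem_cong)
  fix z assume "z \<in> fv \<phi>"
  then show "ev M ((\<theta>(x := V (bvar \<theta> x \<phi>))) z) (e(bvar \<theta> x \<phi> := d)) =
      ((\<lambda>z. ev M (\<theta> z) e)(x := d)) z"
    using bvar_notin[of z \<phi> x \<theta>] by auto
qed

text \<open>Substitution on the syntactic side is a change of environment on the semantic side. Because of this,
  the completeness proof never has to compose two capture-avoiding substitutions, which would
  hold only up to renaming of bound variables.\<close>

lemma sem_psubst: "sem M (psubst \<phi> \<theta>) e = sem M \<phi> (\<lambda>x. ev M (\<theta> x) e)"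
proof (induction \<phi> arbitrary: \<theta> e)
  case (Forall x \<phi>)
  show ?case by (simp only: psubst.simps Let_def sem.simps Forall sem_bvar snd_bvar)
next
  case (Exists x \<phi>)
  show ?case by (simp only: psubst.simps Let_def sem.simps Exists sem_bvar snd_bvar)
next
  case (ForallSt x \<phi>)
  show ?case by (simp only: psubst.simps Let_def sem.simps ForallSt sem_bvar snd_bvar)
next
  case (ExistsSt x \<phi>)
  show ?case by (simp only: psubst.simps Let_def sem.simps ExistsSt sem_bvar snd_bvar)
qed (simp_all add: ev_tsubst)

lemma typed_envD: "typed_env M e \<Longrightarrow> e x \<in> Dom M (snd x)"
  unfolding typed_env_def by (rule spec)

lemma ev_in_Dom:
  "typed_struct M \<Longrightarrow> typed_env M e \<Longrightarrow> tyof t = Some \<tau> \<Longrightarrow> ev M t e \<in> Dom M \<tau>"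
proof (induction t arbitrary: \<tau>)
  case (App s t)
  then obtain \<sigma> where "tyof s = Some (\<sigma> \<rightharpoonup> \<tau>)" "tyof t = Some \<sigma>"
    by (auto split: option.splits ty.splits if_splits)
  then show ?case using App.IH App.prems by (auto simp: typed_struct_def)
qed (auto simp: typed_struct_def typed_env_def)

lemma typed_env_update [simp]:
  "typed_env M e \<Longrightarrow> d \<in> Dom M (snd x) \<Longrightarrow> typed_env M (e(x := d))"
  by (auto simp: typed_env_def)

section \<open>Completeness of the deduction system\<close>

lemma tyof_tsubst:
  "(\<And>x. tyof (\<theta> x) = Some (snd x)) \<Longrightarrow> tyof (tsubst t \<theta>) = tyof t"
  by (induction t) (auto split: option.splits ty.splits)

lemma wff_psubst: "(\<And>x. tyof (\<theta> x) = Some (snd x)) \<Longrightarrow> wff (psubst \<phi> \<theta>) = wff \<phi>"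
  by (induction \<phi> arbitrary: \<theta>) (simp_all add: tyof_tsubst Let_def)

lemma wff_subst [simp]: "tyof t = Some (snd x) \<Longrightarrow> wff (subst \<phi> x t) = wff \<phi>"
  by (rule wff_psubst) simp

lemma size_psubst: "size (psubst \<phi> \<theta>) = size \<phi>"
  by (induction \<phi> arbitrary: \<theta>) (simp_all add: Let_def)

lemma tsubst_V [simp]: "tsubst t V = t"
  by (induction t) auto

lemma bvar_V [simp]: "bvar V x \<phi> = x"
  by (auto simp: bvar_def Let_def)

lemma psubst_V [simp]: "psubst \<phi> V = \<phi>"
  by (induction \<phi>) (simp_all add: Let_def)

instance ty :: countable by countable_datatype
instance cst :: countable by countable_datatype
instance tm :: countable by countable_datatype
instance fm :: countable by countable_datatype

text \<open>One step of the Henkin construction. Since \<open>\<Gamma>\<close> stays finite, ordinary variables can serve as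
  Henkin constants.\<close>

definition extension :: "fm set \<Rightarrow> fm set \<Rightarrow> fm \<Rightarrow> fm set" where
  "extension T \<Gamma> \<psi> =
    (if wff \<psi> \<and> \<not> derives T (insert \<psi> \<Gamma>) Bot
     then case \<psi> of
         Exists x \<chi> \<Rightarrow>
           insert (subst \<chi> x (V (fresh (snd x) ((\<Union>\<phi>\<in>insert \<psi> \<Gamma>. fv \<phi>))))) (insert \<psi> \<Gamma>)
       | _ \<Rightarrow> insert \<psi> \<Gamma>
     else \<Gamma>)"

primrec henkin :: "fm set \<Rightarrow> fm set \<Rightarrow> nat \<Rightarrow> fm set" where
  "henkin T \<Gamma> 0 = \<Gamma>"
| "henkin T \<Gamma> (Suc n) = extension T (henkin T \<Gamma> n) (from_nat n)"

text \<open>The theory is defined by derivability from some stage rather than as a union of stages; the stages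
  increase, so it is deductively closed without a compactness argument.\<close>

definition henkin_theory :: "fm set \<Rightarrow> fm set \<Rightarrow> fm set" where
  "henkin_theory T \<Gamma> = {\<phi>. wff \<phi> \<and> (\<exists>n. derives T (henkin T \<Gamma> n) \<phi>)}"

text \<open>Terms are not identified up to provable equality; equality remains a relation of the structure.\<close>

definition term_struct :: "fm set \<Rightarrow> tm struct" where
  "term_struct \<Theta> = \<lparr> Dom = (\<lambda>\<sigma>. {t. tyof t = Some \<sigma>}), Con = C, Ap = App,
     EqR = (\<lambda>s t. Eq s t \<in> \<Theta>), LeR = (\<lambda>s t. Le s t \<in> \<Theta>), StR = (\<lambda>\<sigma> t. St \<sigma> t \<in> \<Theta>) \<rparr>"

lemma ev_term_struct: "ev (term_struct \<Theta>) t e = tsubst t e"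
  by (induction t) (auto simp: term_struct_def)

lemma derives_insert_neg:
  assumes "derives T \<Gamma> (\<^bold>\<not> \<phi>)" and "wff \<phi>"
  shows "derives T (insert \<phi> \<Gamma>) Bot"
proof (rule derives.ImpE)
  show "derives T (insert \<phi> \<Gamma>) (\<^bold>\<not> \<phi>)" by (rule derives.Weak[OF assms(1)]) blast
qed (use assms(2) in \<open>simp add: derives.Asm\<close>)

lemma extension_mono: "\<Gamma> \<subseteq> extension T \<Gamma> \<psi>"
  by (auto simp: extension_def split: fm.splits)

lemma finite_extension: "finite \<Gamma> \<Longrightarrow> finite (extension T \<Gamma> \<psi>)"
  by (auto simp: extension_def split: fm.splits)

lemma extension_witness:
  assumes "wff \<chi>" and "\<not> derives T (insert (Exists x \<chi>) \<Gamma>) Bot"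
  obtains y where "snd y = snd x" and "subst \<chi> x (V y) \<in> extension T \<Gamma> (Exists x \<chi>)"
proof (rule that)
  show "subst \<chi> x (V (fresh (snd x) (\<Union>\<phi>\<in>insert (Exists x \<chi>) \<Gamma>. fv \<phi>)))
      \<in> extension T \<Gamma> (Exists x \<chi>)"
    using assms by (simp add: extension_def)
qed simp

text \<open>A witness variable that occurs nowhere else satisfies the eigenvariable condition of
  existential elimination, so it cannot introduce an inconsistency.\<close>

lemma extension_consistent:
  assumes "finite \<Gamma>" and "\<not> derives T \<Gamma> Bot"
  shows "\<not> derives T (extension T \<Gamma> \<psi>) Bot"
proof (cases "wff \<psi> \<and> \<not> derives T (insert \<psi> \<Gamma>) Bot")
  case True
  show ?thesis
  proof (cases "\<exists>x \<chi>. \<psi> = Exists x \<chi>")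
    case ex: True
    then obtain x \<chi> where \<psi>: "\<psi> = Exists x \<chi>" by blast
    let ?A = "\<Union>\<phi>\<in>insert \<psi> \<Gamma>. fv \<phi>"
    let ?y = "fresh (snd x) ?A"
    have y: "?y \<notin> ?A" by (rule fresh_notin) (use assms finite_fv in auto)
    have "derives T (insert \<psi> \<Gamma>) (Exists x \<chi>)"
      using True \<psi> by (auto intro: derives.Asm)
    then have "\<not> derives T (insert (subst \<chi> x (V ?y)) (insert \<psi> \<Gamma>)) Bot"
      using True y \<psi> derives.ExistsE[of T "insert \<psi> \<Gamma>" x \<chi> ?y Bot] by auto
    then show ?thesis using True \<psi> by (simp add: extension_def)
  next
    case False
    then have "extension T \<Gamma> \<psi> = insert \<psi> \<Gamma>"
      using True by (auto simp: extension_def split: fm.splits)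
    then show ?thesis using True by simp
  qed
next
  case False
  then show ?thesis using assms by (auto simp: extension_def)
qed

locale henkin_construction =
  fixes T \<Gamma> :: "fm set"
  assumes fin: "finite \<Gamma>" and cons: "\<not> derives T \<Gamma> Bot" and EQ: "ST \<subseteq> T"
begin

abbreviation "\<Theta> \<equiv> henkin_theory T \<Gamma>"

lemma henkin_mono: "m \<le> n \<Longrightarrow> henkin T \<Gamma> m \<subseteq> henkin T \<Gamma> n"
  by (rule lift_Suc_mono_le) (use extension_mono in auto)

lemma henkin_finite_consistent: "finite (henkin T \<Gamma> n) \<and> \<not> derives T (henkin T \<Gamma> n) Bot"
  by (induction n) (use fin cons finite_extension extension_consistent in auto)

lemma theoryI: "derives T (henkin T \<Gamma> n) \<phi> \<Longrightarrow> wff \<phi> \<Longrightarrow> \<phi> \<in> \<Theta>"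
  by (auto simp: henkin_theory_def)

lemma theory_derives: "\<phi> \<in> \<Theta> \<Longrightarrow> \<exists>n. derives T (henkin T \<Gamma> n) \<phi>"
  by (simp add: henkin_theory_def)

lemma theory_derives2:
  assumes "\<phi> \<in> \<Theta>" and "\<psi> \<in> \<Theta>"
  obtains n where "derives T (henkin T \<Gamma> n) \<phi>" and "derives T (henkin T \<Gamma> n) \<psi>"
proof -
  obtain m n where m: "derives T (henkin T \<Gamma> m) \<phi>" and n: "derives T (henkin T \<Gamma> n) \<psi>"
    using assms theory_derives by blast
  have "derives T (henkin T \<Gamma> (max m n)) \<phi>" "derives T (henkin T \<Gamma> (max m n)) \<psi>"
    by (rule derives.Weak[OF m henkin_mono], simp) (rule derives.Weak[OF n henkin_mono], simp)
  then show ?thesis by (rule that)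
qed

lemma Bot_notin: "Bot \<notin> \<Theta>"
  using henkin_finite_consistent by (auto simp: henkin_theory_def)

lemma theory_wff: "\<phi> \<in> \<Theta> \<Longrightarrow> wff \<phi>"
  by (simp add: henkin_theory_def)

lemma in_mp: "\<phi> \<^bold>\<longrightarrow> \<psi> \<in> \<Theta> \<Longrightarrow> \<phi> \<in> \<Theta> \<Longrightarrow> \<psi> \<in> \<Theta>"
proof -
  assume "\<phi> \<^bold>\<longrightarrow> \<psi> \<in> \<Theta>" "\<phi> \<in> \<Theta>"
  moreover from this obtain n
    where "derives T (henkin T \<Gamma> n) (\<phi> \<^bold>\<longrightarrow> \<psi>)" "derives T (henkin T \<Gamma> n) \<phi>"
    by (rule theory_derives2)
  then have "derives T (henkin T \<Gamma> n) \<psi>" by (rule derives.ImpE)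
  ultimately show ?thesis using theory_wff theoryI by fastforce
qed

text \<open>Every formula is considered at the stage given by its number, where it is either added or
  found to contradict the assumptions already present.\<close>

lemma decided:
  assumes "wff \<psi>"
  shows "\<^bold>\<not> \<psi> \<in> \<Theta> \<or> (\<exists>n. extension T (henkin T \<Gamma> n) \<psi> \<subseteq> henkin T \<Gamma> (Suc n) \<and>
    \<not> derives T (insert \<psi> (henkin T \<Gamma> n)) Bot)"
proof (cases "derives T (insert \<psi> (henkin T \<Gamma> (to_nat \<psi>))) Bot")
  case True
  then show ?thesis using assms by (auto intro!: theoryI derives.ImpI)
next
  case False
  then show ?thesis by (intro disjI2 exI[of _ "to_nat \<psi>"]) simp
qed

lemma negation_complete: "wff \<psi> \<Longrightarrow> \<psi> \<in> \<Theta> \<or> \<^bold>\<not> \<psi> \<in> \<Theta>"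
proof -
  assume wf: "wff \<psi>"
  have "\<psi> \<in> \<Theta>" if "extension T (henkin T \<Gamma> n) \<psi> \<subseteq> henkin T \<Gamma> (Suc n)"
    "\<not> derives T (insert \<psi> (henkin T \<Gamma> n)) Bot" for n
  proof -
    have "\<psi> \<in> extension T (henkin T \<Gamma> n) \<psi>"
      using that wf by (auto simp: extension_def split: fm.splits)
    then have "derives T (henkin T \<Gamma> (Suc n)) \<psi>" using that wf derives.Asm by blast
    then show ?thesis using wf by (rule theoryI)
  qed
  then show ?thesis using decided[OF wf] by blast
qed

lemma not_in: "wff \<psi> \<Longrightarrow> \<^bold>\<not> \<psi> \<in> \<Theta> \<longleftrightarrow> \<psi> \<notin> \<Theta>"
  using negation_complete in_mp Bot_notin by blast

lemma in_Imp: "wff (\<phi> \<^bold>\<longrightarrow> \<psi>) \<Longrightarrow> \<phi> \<^bold>\<longrightarrow> \<psi> \<in> \<Theta> \<longleftrightarrow> (\<phi> \<in> \<Theta> \<longrightarrow> \<psi> \<in> \<Theta>)"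
proof (intro iffI impI)
  assume wf: "wff (\<phi> \<^bold>\<longrightarrow> \<psi>)" and imp: "\<phi> \<in> \<Theta> \<longrightarrow> \<psi> \<in> \<Theta>"
  show "\<phi> \<^bold>\<longrightarrow> \<psi> \<in> \<Theta>"
  proof (cases "\<phi> \<in> \<Theta>")
    case True
    then have "\<psi> \<in> \<Theta>" using imp by simp
    then obtain n where "derives T (henkin T \<Gamma> n) \<psi>" using theory_derives by blast
    then have "derives T (insert \<phi> (henkin T \<Gamma> n)) \<psi>" by (rule derives.Weak) blast
    then have "derives T (henkin T \<Gamma> n) (\<phi> \<^bold>\<longrightarrow> \<psi>)" using wf derives.ImpI by simp
    then show ?thesis using wf by (rule theoryI)
  next
    case False
    then have "\<^bold>\<not> \<phi> \<in> \<Theta>" using wf not_in by simp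
    then obtain n where "derives T (henkin T \<Gamma> n) (\<^bold>\<not> \<phi>)" using theory_derives by blast
    then have "derives T (insert \<phi> (henkin T \<Gamma> n)) \<psi>"
      using wf derives_insert_neg derives.BotE by simp
    then have "derives T (henkin T \<Gamma> n) (\<phi> \<^bold>\<longrightarrow> \<psi>)" using wf derives.ImpI by simp
    then show ?thesis using wf by (rule theoryI)
  qed
qed (rule in_mp)

lemma in_Conj: "\<phi> \<^bold>\<and> \<psi> \<in> \<Theta> \<longleftrightarrow> \<phi> \<in> \<Theta> \<and> \<psi> \<in> \<Theta>"
proof
  assume c: "\<phi> \<^bold>\<and> \<psi> \<in> \<Theta>"
  then have "wff \<phi>" "wff \<psi>" using theory_wff by fastforce+
  then show "\<phi> \<in> \<Theta> \<and> \<psi> \<in> \<Theta>"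
    using c derives.ConjE1[of T _ \<phi> \<psi>] derives.ConjE2[of T _ \<phi> \<psi>]
    unfolding henkin_theory_def by auto
next
  assume both: "\<phi> \<in> \<Theta> \<and> \<psi> \<in> \<Theta>"
  then obtain n where "derives T (henkin T \<Gamma> n) \<phi>" "derives T (henkin T \<Gamma> n) \<psi>"
    using theory_derives2 by blast
  then have "derives T (henkin T \<Gamma> n) (\<phi> \<^bold>\<and> \<psi>)" by (rule derives.ConjI)
  then show "\<phi> \<^bold>\<and> \<psi> \<in> \<Theta>" by (rule theoryI) (use both theory_wff in auto)
qed

lemma in_Disj: "wff (\<phi> \<^bold>\<or> \<psi>) \<Longrightarrow> \<phi> \<^bold>\<or> \<psi> \<in> \<Theta> \<longleftrightarrow> \<phi> \<in> \<Theta> \<or> \<psi> \<in> \<Theta>"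
proof
  assume wf: "wff (\<phi> \<^bold>\<or> \<psi>)" and d: "\<phi> \<^bold>\<or> \<psi> \<in> \<Theta>"
  show "\<phi> \<in> \<Theta> \<or> \<psi> \<in> \<Theta>"
  proof (rule ccontr)
    assume "\<not> ?thesis"
    then have "\<^bold>\<not> \<phi> \<^bold>\<and> \<^bold>\<not> \<psi> \<in> \<Theta>" using wf not_in in_Conj by auto
    then obtain n where n: "derives T (henkin T \<Gamma> n) (\<phi> \<^bold>\<or> \<psi>)"
      "derives T (henkin T \<Gamma> n) (\<^bold>\<not> \<phi> \<^bold>\<and> \<^bold>\<not> \<psi>)"
      using theory_derives2[OF d] by blast
    have "derives T (insert \<phi> (henkin T \<Gamma> n)) Bot"
      using derives.ConjE1[OF n(2)] wf by (simp add: derives_insert_neg)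
    moreover have "derives T (insert \<psi> (henkin T \<Gamma> n)) Bot"
      using derives.ConjE2[OF n(2)] wf by (simp add: derives_insert_neg)
    ultimately have "derives T (henkin T \<Gamma> n) Bot" by (rule derives.DisjE[OF n(1)])
    then show False using henkin_finite_consistent by blast
  qed
next
  assume "wff (\<phi> \<^bold>\<or> \<psi>)" "\<phi> \<in> \<Theta> \<or> \<psi> \<in> \<Theta>"
  then show "\<phi> \<^bold>\<or> \<psi> \<in> \<Theta>"
    unfolding henkin_theory_def using derives.DisjI1[of T _ \<phi> \<psi>] derives.DisjI2[of T _ \<psi> \<phi>] by auto
qed

lemma in_Exists:
  assumes wf: "wff \<chi>"
  shows "Exists x \<chi> \<in> \<Theta> \<longleftrightarrow> (\<exists>t. tyof t = Some (snd x) \<and> subst \<chi> x t \<in> \<Theta>)"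
proof
  assume ex: "Exists x \<chi> \<in> \<Theta>"
  then have "\<^bold>\<not> Exists x \<chi> \<notin> \<Theta>" using in_mp Bot_notin by blast
  then obtain n where n: "extension T (henkin T \<Gamma> n) (Exists x \<chi>) \<subseteq> henkin T \<Gamma> (Suc n)"
    "\<not> derives T (insert (Exists x \<chi>) (henkin T \<Gamma> n)) Bot"
    using decided[of "Exists x \<chi>"] wf by auto
  then obtain y where "snd y = snd x" "subst \<chi> x (V y) \<in> henkin T \<Gamma> (Suc n)"
    using extension_witness[OF wf n(2)] by blast
  then show "\<exists>t. tyof t = Some (snd x) \<and> subst \<chi> x t \<in> \<Theta>"
    using wf derives.Asm[of "subst \<chi> x (V y)" "henkin T \<Gamma> (Suc n)" T]
      theoryI[of "Suc n" "subst \<chi> x (V y)"] by (intro exI[of _ "V y"]) simp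
next
  assume "\<exists>t. tyof t = Some (snd x) \<and> subst \<chi> x t \<in> \<Theta>"
  then obtain t n where "tyof t = Some (snd x)" "derives T (henkin T \<Gamma> n) (subst \<chi> x t)"
    by (auto simp: henkin_theory_def)
  then have "derives T (henkin T \<Gamma> n) (Exists x \<chi>)" using wf derives.ExistsI by simp
  then show "Exists x \<chi> \<in> \<Theta>" using wf theoryI by simp
qed

text \<open>A counterexample to a universal formula is a Henkin witness of \<open>\<exists>x. \<not> \<chi>\<close>, so the converse
  direction amounts to the classical derivation of \<open>\<forall>x. \<chi>\<close> from \<open>\<not> (\<exists>x. \<not> \<chi>)\<close>.\<close>

lemma in_Forall:
  assumes wf: "wff \<chi>"
  shows "Forall x \<chi> \<in> \<Theta> \<longleftrightarrow> (\<forall>t. tyof t = Some (snd x) \<longrightarrow> subst \<chi> x t \<in> \<Theta>)"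
proof
  assume "Forall x \<chi> \<in> \<Theta>"
  then obtain n where n: "derives T (henkin T \<Gamma> n) (Forall x \<chi>)"
    by (auto simp: henkin_theory_def)
  show "\<forall>t. tyof t = Some (snd x) \<longrightarrow> subst \<chi> x t \<in> \<Theta>"
  proof (intro allI impI)
    fix t assume t: "tyof t = Some (snd x)"
    show "subst \<chi> x t \<in> \<Theta>"
      by (rule theoryI[OF derives.ForallE[OF n t]]) (use wf t in simp)
  qed
next
  assume all: "\<forall>t. tyof t = Some (snd x) \<longrightarrow> subst \<chi> x t \<in> \<Theta>"
  show "Forall x \<chi> \<in> \<Theta>"
  proof (rule ccontr)
    assume "Forall x \<chi> \<notin> \<Theta>"
    then have "\<^bold>\<not> Forall x \<chi> \<in> \<Theta>" using not_in wf by simp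
    moreover have "Exists x (\<^bold>\<not> \<chi>) \<notin> \<Theta>"
    proof
      assume "Exists x (\<^bold>\<not> \<chi>) \<in> \<Theta>"
      then obtain t where "tyof t = Some (snd x)" "\<^bold>\<not> subst \<chi> x t \<in> \<Theta>"
        using in_Exists[of "\<^bold>\<not> \<chi>"] wf by auto
      then show False using all in_mp Bot_notin by blast
    qed
    then have "\<^bold>\<not> Exists x (\<^bold>\<not> \<chi>) \<in> \<Theta>" using not_in wf by simp
    ultimately obtain n where n: "derives T (henkin T \<Gamma> n) (\<^bold>\<not> Forall x \<chi>)"
      "derives T (henkin T \<Gamma> n) (\<^bold>\<not> Exists x (\<^bold>\<not> \<chi>))"
      using theory_derives2 by blast
    let ?\<Gamma> = "henkin T \<Gamma> n"
    let ?A = "(\<Union>\<psi>\<in>?\<Gamma>. fv \<psi>) \<union> fv (Forall x \<chi>)"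
    let ?y = "fresh (snd x) ?A"
    let ?\<chi> = "subst \<chi> x (V ?y)"
    have y: "?y \<notin> ?A"
      by (rule fresh_notin) (use henkin_finite_consistent finite_fv in auto)
    have "derives T ?\<Gamma> ?\<chi>"
    proof (rule derives.Class)
      have "derives T (insert (\<^bold>\<not> ?\<chi>) ?\<Gamma>) (subst (\<^bold>\<not> \<chi>) x (V ?y))"
        using wf by (auto intro!: derives.Asm)
      then have "derives T (insert (\<^bold>\<not> ?\<chi>) ?\<Gamma>) (Exists x (\<^bold>\<not> \<chi>))"
        by (rule derives.ExistsI) (use wf in auto)
      moreover have "derives T (insert (\<^bold>\<not> ?\<chi>) ?\<Gamma>) (\<^bold>\<not> Exists x (\<^bold>\<not> \<chi>))"
        by (rule derives.Weak[OF n(2)]) blast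
      ultimately show "derives T (insert (\<^bold>\<not> ?\<chi>) ?\<Gamma>) Bot" by (rule derives.ImpE[rotated])
    qed (use wf in simp)
    then have "derives T ?\<Gamma> (Forall x \<chi>)" by (rule derives.ForallI[OF _ _ y]) simp
    then have "derives T ?\<Gamma> Bot" by (rule derives.ImpE[OF n(1)])
    then show False using henkin_finite_consistent by blast
  qed
qed

lemma axiom_in: "\<phi> \<in> T \<Longrightarrow> wff \<phi> \<Longrightarrow> \<phi> \<in> \<Theta>"
  using derives.Ax theoryI by blast

lemma in_ForallSt:
  assumes "wff \<chi>"
  shows "ForallSt x \<chi> \<in> \<Theta> \<longleftrightarrow> Forall x (St (snd x) (V x) \<^bold>\<longrightarrow> \<chi>) \<in> \<Theta>"
proof -
  have "ForallSt x \<chi> \<^bold>\<longleftrightarrow> Forall x (St (snd x) (V x) \<^bold>\<longrightarrow> \<chi>) \<in> \<Theta>"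
    by (rule axiom_in[OF subsetD[OF EQ ST.EQ_all[OF assms]]]) (use assms in simp)
  then show ?thesis using in_Conj in_mp by blast
qed

lemma in_ExistsSt:
  assumes "wff \<chi>"
  shows "ExistsSt x \<chi> \<in> \<Theta> \<longleftrightarrow> Exists x (St (snd x) (V x) \<^bold>\<and> \<chi>) \<in> \<Theta>"
proof -
  have "ExistsSt x \<chi> \<^bold>\<longleftrightarrow> Exists x (St (snd x) (V x) \<^bold>\<and> \<chi>) \<in> \<Theta>"
    by (rule axiom_in[OF subsetD[OF EQ ST.EQ_ex[OF assms]]]) (use assms in simp)
  then show ?thesis using in_Conj in_mp by blast
qed

abbreviation "\<M> \<equiv> term_struct \<Theta>"

lemma sem_subst: "sem \<M> \<chi> (V(x := t)) = sem \<M> (subst \<chi> x t) V"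
  by (simp add: sem_psubst ev_term_struct fun_upd_def)

text \<open>The induction is on size and not on structure: the instance of the body of a quantifier is a
  substituted formula, of the same size as the body. In the quantifier cases the semantic
  substitution lemma turns an updated environment into such an instance.\<close>

lemma truth: "wff \<phi> \<Longrightarrow> sem \<M> \<phi> V \<longleftrightarrow> \<phi> \<in> \<Theta>"
proof (induction \<phi> rule: measure_induct_rule[of size])
  case (less \<phi>)
  have inst: "sem \<M> \<chi> (V(x := t)) \<longleftrightarrow> subst \<chi> x t \<in> \<Theta>"
    if "tyof t = Some (snd x)" "wff \<chi>" "size \<chi> < size \<phi>" for \<chi> x t
    using that less.IH[of "subst \<chi> x t"] by (simp add: sem_subst size_psubst)
  have Dom: "Dom \<M> \<sigma> = {t. tyof t = Some \<sigma>}" for \<sigma> by (simp add: term_struct_def)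
  show ?case
  proof (cases \<phi>)
    case (Imp \<chi> \<psi>)
    then show ?thesis using less.IH[of \<chi>] less.IH[of \<psi>] less.prems in_Imp by simp
  next
    case (Conj \<chi> \<psi>)
    then show ?thesis using less.IH[of \<chi>] less.IH[of \<psi>] less.prems in_Conj by simp
  next
    case (Disj \<chi> \<psi>)
    then show ?thesis using less.IH[of \<chi>] less.IH[of \<psi>] less.prems in_Disj by simp
  next
    case (Forall x \<chi>)
    then show ?thesis using less.prems inst[of _ x \<chi>] by (auto simp: in_Forall Dom)
  next
    case (Exists x \<chi>)
    then show ?thesis using less.prems inst[of _ x \<chi>] by (auto simp: in_Exists Dom)
  next
    case (ForallSt x \<chi>)
    have "subst (St (snd x) (V x) \<^bold>\<longrightarrow> \<chi>) x t \<in> \<Theta> \<longleftrightarrow>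
        (St (snd x) t \<in> \<Theta> \<longrightarrow> subst \<chi> x t \<in> \<Theta>)" if "tyof t = Some (snd x)" for t
      using that less.prems ForallSt in_Imp by simp
    moreover have "StR \<M> \<sigma> t \<longleftrightarrow> St \<sigma> t \<in> \<Theta>" for \<sigma> t by (simp add: term_struct_def)
    ultimately show ?thesis using ForallSt less.prems inst[of _ x \<chi>]
      by (simp add: in_ForallSt in_Forall Dom)
  next
    case (ExistsSt x \<chi>)
    have "subst (St (snd x) (V x) \<^bold>\<and> \<chi>) x t \<in> \<Theta> \<longleftrightarrow>
        (St (snd x) t \<in> \<Theta> \<and> subst \<chi> x t \<in> \<Theta>)" if "tyof t = Some (snd x)" for t
      using that less.prems ExistsSt in_Conj by simp
    moreover have "StR \<M> \<sigma> t \<longleftrightarrow> St \<sigma> t \<in> \<Theta>" for \<sigma> t by (simp add: term_struct_def)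
    ultimately show ?thesis using ExistsSt less.prems inst[of _ x \<chi>]
      by (auto simp add: in_ExistsSt in_Exists Dom)
  qed (use Bot_notin in \<open>simp_all add: ev_term_struct, simp_all add: term_struct_def\<close>)
qed

lemma typed_term_struct: "typed_struct \<M>"
  by (simp add: typed_struct_def term_struct_def)

lemma derives_closure: "derives T {} \<phi> \<Longrightarrow> derives T {} (foldr Forall xs \<phi>)"
proof (induction xs)
  case (Cons x xs)
  then show ?case using derives.ForallI[of T "{}" "foldr Forall xs \<phi>" x x] by simp
qed simp

lemma closure_true:
  "sem M (foldr Forall xs \<phi>) e \<Longrightarrow> (\<And>x. x \<in> set xs \<Longrightarrow> e' x \<in> Dom M (snd x)) \<Longrightarrow>
   (\<And>x. x \<notin> set xs \<Longrightarrow> e' x = e x) \<Longrightarrow> sem M \<phi> e'"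
proof (induction xs arbitrary: e)
  case Nil
  have "e' = e" by (rule HOL.ext) (rule Nil.prems(3), simp)
  with Nil.prems(1) show ?case by simp
next
  case (Cons x xs)
  have "sem M (foldr Forall xs \<phi>) (e(x := e' x))"
    using Cons.prems(1) Cons.prems(2)[of x] by simp
  then show ?case
  proof (rule Cons.IH)
    show "e' z \<in> Dom M (snd z)" if "z \<in> set xs" for z using that by (intro Cons.prems(2)) simp
    show "e' z = (e(x := e' x)) z" if "z \<notin> set xs" for z
      using that Cons.prems(3)[of z] by auto
  qed
qed

text \<open>An open axiom stands for its universal closure: it is derivable without assumptions, hence so is
  the closure, whose truth under one environment gives the truth of the axiom under all.\<close>

lemma axiom_valid:
  assumes "\<phi> \<in> T" and "wff \<phi>"
  shows "valid \<M> \<phi>"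
  unfolding valid_def
proof (intro allI impI)
  fix e assume e: "typed_env \<M> e"
  obtain xs where xs: "set xs = fv \<phi>" using finite_list[OF finite_fv] by blast
  have wf: "wff (foldr Forall xs \<phi>)" by (induction xs) (use assms in auto)
  have "derives T (henkin T \<Gamma> 0) (foldr Forall xs \<phi>)"
    by (rule derives.Weak[OF derives_closure[OF derives.Ax[OF assms(1)]]]) simp
  then have "foldr Forall xs \<phi> \<in> \<Theta>" using wf by (rule theoryI)
  then have "sem \<M> (foldr Forall xs \<phi>) V" using truth[OF wf] by simp
  then have "sem \<M> \<phi> (\<lambda>x. if x \<in> set xs then e x else V x)" (is "sem _ _ ?e'")
    by (rule closure_true) (simp_all add: typed_envD[OF e])
  moreover have "sem \<M> \<phi> ?e' = sem \<M> \<phi> e" by (rule sem_cong) (simp add: xs)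
  ultimately show "sem \<M> \<phi> e" by simp
qed

end

theorem completeness:
  assumes "ST \<subseteq> T" and "wff \<phi>"
    and true: "\<And>M :: tm struct. typed_struct M \<Longrightarrow> (\<And>\<psi>. \<psi> \<in> T \<Longrightarrow> wff \<psi> \<Longrightarrow> valid M \<psi>) \<Longrightarrow> valid M \<phi>"
  shows "T \<turnstile> \<phi>"
proof (rule ccontr)
  assume not: "\<not> T \<turnstile> \<phi>"
  then have "\<not> derives T {\<^bold>\<not> \<phi>} Bot" using derives.Class assms(2) by blast
  then interpret henkin_construction T "{\<^bold>\<not> \<phi>}" using assms by unfold_locales auto
  have "valid \<M> \<phi>" using true typed_term_struct axiom_valid by blast
  moreover have "typed_env \<M> V" by (simp add: typed_env_def term_struct_def)
  ultimately have "sem \<M> \<phi> V" unfolding valid_def by blast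
  then have "\<phi> \<in> \<Theta>" using truth assms(2) by simp
  moreover have "\<^bold>\<not> \<phi> \<in> \<Theta>" using assms(2) by (intro theoryI[of 0] derives.Asm) auto
  ultimately show False using in_mp Bot_notin by blast
qed

section \<open>The combinatory part of the base theory in a model\<close>

text \<open>The relation denoted by the formula \<open>eqt\<close>, that is, extensional equality.\<close>

primrec eqv :: "('d, 'm) struct_scheme \<Rightarrow> ty \<Rightarrow> 'd \<Rightarrow> 'd \<Rightarrow> bool" where
  "eqv M N a b = EqR M a b"
| "eqv M (\<sigma> \<rightharpoonup> \<tau>) a b = (\<forall>d \<in> Dom M \<sigma>. eqv M \<tau> (Ap M a d) (Ap M b d))"

lemma sem_eqt: "sem M (eqt \<tau> s t) e = eqv M \<tau> (ev M s e) (ev M t e)"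
proof (induction \<tau> arbitrary: s t e)
  case (Arr \<sigma> \<tau>)
  let ?z = "fresh \<sigma> (fvt s \<union> fvt t)"
  have "?z \<notin> fvt s \<union> fvt t" by (rule fresh_notin) (simp add: finite_fvt)
  then show ?case by (simp only: eqt.simps Let_def sem.simps Arr.IH ev.simps eqv.simps snd_fresh
    Un_iff de_Morgan_disj ev_update_fresh fun_upd_same simp_thms)
qed simp

lemma wff_eqt: "tyof s = Some \<tau> \<Longrightarrow> tyof t = Some \<tau> \<Longrightarrow> wff (eqt \<tau> s t)"
  by (induction \<tau> arbitrary: s t) (simp_all add: Let_def)

lemma tyof_AppE:
  assumes "tyof (s \<cdot> t) = Some \<tau>"
  obtains \<sigma> where "tyof s = Some (\<sigma> \<rightharpoonup> \<tau>)" and "tyof t = Some \<sigma>"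
  using assms by (auto split: option.splits ty.splits if_splits)

lemma tyof_lam [simp]: "tyof t = Some \<tau> \<Longrightarrow> tyof (lam x t) = Some (snd x \<rightharpoonup> \<tau>)"
proof (induction t arbitrary: \<tau>)
  case (App s t)
  obtain \<sigma> where "tyof s = Some (\<sigma> \<rightharpoonup> \<tau>)" and "tyof t = Some \<sigma>"
    using App.prems by (rule tyof_AppE)
  then show ?case using App.IH by (simp add: Let_def)
qed (auto simp: Let_def)

lemma fvt_lam [simp]: "fvt (lam x t) = fvt t - {x}"
  by (induction t) (auto simp: Let_def)

lemma sem_update_fresh [simp]: "x \<notin> fv \<phi> \<Longrightarrow> sem M \<phi> (e(x := d)) = sem M \<phi> e"
  by (rule sem_cong) auto

abbreviation (input) "theory_ATR \<equiv> B0 \<union> {exists2} \<union> QF_AC 1 1"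

locale model =
  fixes M :: "'d struct"
  assumes typed: "typed_struct M"
    and ax: "\<And>\<psi>. \<psi> \<in> theory_ATR \<Longrightarrow> wff \<psi> \<Longrightarrow> valid M \<psi>"
    and env: "\<exists>e. typed_env M e"
begin

abbreviation D :: "ty \<Rightarrow> 'd set" where "D \<equiv> Dom M"
abbreviation app :: "'d \<Rightarrow> 'd \<Rightarrow> 'd" (infixl "\<bullet>" 200) where "a \<bullet> b \<equiv> Ap M a b"
abbreviation eq0 :: "'d \<Rightarrow> 'd \<Rightarrow> bool" (infix "\<approx>" 50) where "a \<approx> b \<equiv> EqR M a b"
abbreviation zero :: 'd ("\<zero>") where "\<zero> \<equiv> Con M cZero"
abbreviation Std :: "ty \<Rightarrow> 'd \<Rightarrow> bool" where "Std \<equiv> StR M"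

text \<open>An arbitrary environment, updated at the variables of an axiom to read the axiom off at given
  objects.\<close>

definition e0 :: "var \<Rightarrow> 'd" where "e0 = (SOME e. typed_env M e)"

lemma typed_e0 [simp]: "typed_env M e0"
  unfolding e0_def using env by (rule someI_ex)

lemma axiom_sem: "\<psi> \<in> theory_ATR \<Longrightarrow> wff \<psi> \<Longrightarrow> typed_env M e \<Longrightarrow> sem M \<psi> e"
  using ax unfolding valid_def by blast

lemma EFA_sem: "\<psi> \<in> E_EFA \<Longrightarrow> wff \<psi> \<Longrightarrow> typed_env M e \<Longrightarrow> sem M \<psi> e"
  by (rule axiom_sem) (simp_all add: B0_def)

lemma ST_sem: "\<psi> \<in> ST \<Longrightarrow> wff \<psi> \<Longrightarrow> typed_env M e \<Longrightarrow> sem M \<psi> e"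
  by (rule axiom_sem) (simp_all add: B0_def)

lemma con_in_D [simp]: "Con M c \<in> D (cty c)"
  using typed by (simp add: typed_struct_def)

lemma zero_in_D [simp]: "\<zero> \<in> D N"
  using con_in_D[of cZero] by simp

lemma app_in_D [simp]: "a \<in> D (\<sigma> \<rightharpoonup> \<tau>) \<Longrightarrow> b \<in> D \<sigma> \<Longrightarrow> a \<bullet> b \<in> D \<tau>"
  using typed by (auto simp: typed_struct_def)

lemma suc_in_D [simp]: "a \<in> D N \<Longrightarrow> Con M cSucc \<bullet> a \<in> D N"
  using con_in_D[of cSucc] by simp

lemmas ev_in_D = ev_in_Dom[OF typed]

lemma eq0_refl [simp]: "a \<in> D N \<Longrightarrow> a \<approx> a"
  using EFA_sem[OF E_EFA.eq_refl, of "e0(nn := a)"] by simp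

lemma eq0_sym: "a \<in> D N \<Longrightarrow> b \<in> D N \<Longrightarrow> a \<approx> b \<Longrightarrow> b \<approx> a"
  using EFA_sem[OF E_EFA.eq_sym, of "e0(nn := a, kk := b)"] by simp

lemma eq0_trans: "a \<in> D N \<Longrightarrow> b \<in> D N \<Longrightarrow> c \<in> D N \<Longrightarrow> a \<approx> b \<Longrightarrow> b \<approx> c \<Longrightarrow> a \<approx> c"
  using EFA_sem[OF E_EFA.eq_trans, of "e0(nn := a, kk := b, rr := c)"] by simp

lemma eq0_cong: "a \<in> D N \<Longrightarrow> b \<in> D N \<Longrightarrow> c \<in> D N \<Longrightarrow> a \<approx> b \<Longrightarrow> a \<approx> c \<longleftrightarrow> b \<approx> c"
  using eq0_sym eq0_trans by blast

lemma le_congI: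
  assumes "a \<in> D N" "b \<in> D N" "a' \<in> D N" "b' \<in> D N" "a \<approx> a'" "b \<approx> b'" "LeR M a b"
  shows "LeR M a' b'"
  using EFA_sem[OF E_EFA.le_cong, of "e0(nn := a, kk := b, rr := a', (3, N) := b')"] assms by simp

lemma le_zero_iff: "a \<in> D N \<Longrightarrow> LeR M a \<zero> \<longleftrightarrow> a \<approx> \<zero>"
  using EFA_sem[OF E_EFA.le_zero, of "e0(nn := a)"] by auto

lemma le_suc_iff:
  "a \<in> D N \<Longrightarrow> b \<in> D N \<Longrightarrow>
    LeR M a (Con M cSucc \<bullet> b) \<longleftrightarrow> LeR M a b \<or> a \<approx> Con M cSucc \<bullet> b"
  using EFA_sem[OF E_EFA.le_suc, of "e0(nn := a, kk := b)"] by auto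

lemma one_neq_zero: "\<not> Con M cSucc \<bullet> \<zero> \<approx> \<zero>"
  using EFA_sem[OF E_EFA.suc_neq, of "e0(nn := \<zero>)"] by simp

text \<open>Reflexivity of \<open>\<le>\<close> is not an axiom and takes an induction.\<close>

lemma le_refl: "a \<in> D N \<Longrightarrow> LeR M a a"
proof -
  assume a: "a \<in> D N"
  have "sem M (Forall nn (Le (V nn) (V nn))) e0"
    using EFA_sem[OF E_EFA.QF_IA[of "Le (V nn) (V nn)" nn], of e0]
    by (simp add: le_zero_iff le_suc_iff)
  then show ?thesis using a by simp
qed

lemma le_suc_self: "a \<in> D N \<Longrightarrow> LeR M a (Con M cSucc \<bullet> a)"
  by (simp add: le_suc_iff le_refl)

lemma eqv_trans:
  "a \<in> D \<tau> \<Longrightarrow> b \<in> D \<tau> \<Longrightarrow> c \<in> D \<tau> \<Longrightarrow> eqv M \<tau> a b \<Longrightarrow> eqv M \<tau> b c \<Longrightarrow> eqv M \<tau> a c"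
proof (induction \<tau> arbitrary: a b c)
  case N
  then show ?case using eq0_trans[of a b c] by simp
next
  case (Arr \<sigma> \<tau>)
  show ?case
    unfolding eqv.simps
  proof
    fix d assume "d \<in> D \<sigma>"
    then show "eqv M \<tau> (a \<bullet> d) (c \<bullet> d)"
      by (intro Arr.IH(2)[of "a \<bullet> d" "b \<bullet> d" "c \<bullet> d"] app_in_D)
        (use Arr.prems in auto)
  qed
qed

lemma Pi_eqv:
  assumes "a \<in> D \<rho>" "b \<in> D \<tau>"
  shows "eqv M \<rho> (Con M (cPi \<rho> \<tau>) \<bullet> a \<bullet> b) a"
  using EFA_sem[OF E_EFA.Pi, of \<rho> \<tau> "e0((0, \<rho>) := a, (1, \<tau>) := b)"] assms
  by (simp add: sem_eqt wff_eqt)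

lemma Sig_eqv:
  assumes "a \<in> D (\<delta> \<rightharpoonup> \<rho> \<rightharpoonup> \<tau>)" "b \<in> D (\<delta> \<rightharpoonup> \<rho>)" "c \<in> D \<delta>"
  shows "eqv M \<tau> (Con M (cSig \<delta> \<rho> \<tau>) \<bullet> a \<bullet> b \<bullet> c) (a \<bullet> c \<bullet> (b \<bullet> c))"
  using EFA_sem[OF E_EFA.Sig, of \<tau> \<delta> \<rho>
      "e0((0, \<delta> \<rightharpoonup> \<rho> \<rightharpoonup> \<tau>) := a, (1, \<delta> \<rightharpoonup> \<rho>) := b, (2, \<delta>) := c)"] assms
  by (simp add: sem_eqt wff_eqt)

lemma extensionality:
  assumes "f \<in> D (\<rho> \<rightharpoonup> \<tau>)" "a \<in> D \<rho>" "b \<in> D \<rho>" "eqv M \<rho> a b"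
  shows "eqv M \<tau> (f \<bullet> a) (f \<bullet> b)"
  using EFA_sem[OF E_EFA.ext, of \<rho> \<tau> "e0((0, \<rho>) := a, (1, \<rho>) := b, (2, \<rho> \<rightharpoonup> \<tau>) := f)"] assms
  by (simp add: sem_eqt wff_eqt)

lemma app_eqv:
  assumes "f \<in> D (\<rho> \<rightharpoonup> \<tau>)" "g \<in> D (\<rho> \<rightharpoonup> \<tau>)" "a \<in> D \<rho>" "b \<in> D \<rho>"
    and "eqv M (\<rho> \<rightharpoonup> \<tau>) f g" "eqv M \<rho> a b"
  shows "eqv M \<tau> (f \<bullet> a) (g \<bullet> b)"
  by (rule eqv_trans[of _ _ "f \<bullet> b"]) (use assms extensionality in auto)

text \<open>The combinator translation of abstraction satisfies beta conversion only up to extensional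
  equality, so the axiom of extensionality enters where an application is translated.\<close>

lemma lam_beta:
  assumes "typed_env M e" "d \<in> D (snd x)" "tyof t = Some \<tau>"
  shows "eqv M \<tau> (ev M (lam x t) e \<bullet> d) (ev M t (e(x := d)))"
  using assms(3)
proof (induction t arbitrary: \<tau>)
  case (V y)
  show ?case
  proof (cases "y = x")
    case True
    let ?\<sigma> = "snd x"
    let ?P = "Con M (cPi ?\<sigma> (?\<sigma> \<rightharpoonup> ?\<sigma>))" and ?Q = "Con M (cPi ?\<sigma> ?\<sigma>)"
    have P: "?P \<in> D (?\<sigma> \<rightharpoonup> (?\<sigma> \<rightharpoonup> ?\<sigma>) \<rightharpoonup> ?\<sigma>)" and Q: "?Q \<in> D (?\<sigma> \<rightharpoonup> ?\<sigma> \<rightharpoonup> ?\<sigma>)"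
      and S: "Con M (cSig ?\<sigma> (?\<sigma> \<rightharpoonup> ?\<sigma>) ?\<sigma>) \<in>
        D ((?\<sigma> \<rightharpoonup> (?\<sigma> \<rightharpoonup> ?\<sigma>) \<rightharpoonup> ?\<sigma>) \<rightharpoonup> (?\<sigma> \<rightharpoonup> ?\<sigma> \<rightharpoonup> ?\<sigma>) \<rightharpoonup> ?\<sigma> \<rightharpoonup> ?\<sigma>)"
      using con_in_D[of "cPi ?\<sigma> (?\<sigma> \<rightharpoonup> ?\<sigma>)"] con_in_D[of "cPi ?\<sigma> ?\<sigma>"]
        con_in_D[of "cSig ?\<sigma> (?\<sigma> \<rightharpoonup> ?\<sigma>) ?\<sigma>"] by simp_all
    have "eqv M ?\<sigma> (Con M (cSig ?\<sigma> (?\<sigma> \<rightharpoonup> ?\<sigma>) ?\<sigma>) \<bullet> ?P \<bullet> ?Q \<bullet> d) d"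
    proof (rule eqv_trans[OF _ _ _ Sig_eqv])
      show "eqv M ?\<sigma> (?P \<bullet> d \<bullet> (?Q \<bullet> d)) d"
        by (rule Pi_eqv) (use assms(2) Q in auto)
      show "Con M (cSig ?\<sigma> (?\<sigma> \<rightharpoonup> ?\<sigma>) ?\<sigma>) \<bullet> ?P \<bullet> ?Q \<bullet> d \<in> D ?\<sigma>"
        using app_in_D[OF app_in_D[OF app_in_D[OF S P] Q] assms(2)] .
      show "?P \<bullet> d \<bullet> (?Q \<bullet> d) \<in> D ?\<sigma>"
        using app_in_D[OF app_in_D[OF P assms(2)] app_in_D[OF Q assms(2)]] .
    qed (use assms(2) P Q in auto)
    then show ?thesis using True V by (simp add: Let_def)
  next
    case False
    then show ?thesis
      using V Pi_eqv[OF typed_envD[OF assms(1)] assms(2), of y] by (auto simp: Let_def)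
  qed
next
  case (C c)
  then show ?case using Pi_eqv[OF con_in_D[of c] assms(2)] by auto
next
  case (App s t)
  obtain \<rho> where s: "tyof s = Some (\<rho> \<rightharpoonup> \<tau>)" and t: "tyof t = Some \<rho>"
    using App.prems by (rule tyof_AppE)
  have st: "tyof (s \<cdot> t) = Some \<tau>" by (rule App.prems)
  show ?case
  proof (cases "x \<in> fvt (s \<cdot> t)")
    case True
    let ?s = "ev M (lam x s) e" and ?t = "ev M (lam x t) e"
    let ?e = "e(x := d)"
    have e: "typed_env M ?e" using assms by simp
    have sD: "?s \<in> D (snd x \<rightharpoonup> \<rho> \<rightharpoonup> \<tau>)" and tD: "?t \<in> D (snd x \<rightharpoonup> \<rho>)"
      using s t assms(1) by (auto intro!: ev_in_D)
    have S: "Con M (cSig (snd x) \<rho> \<tau>) \<in>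
        D ((snd x \<rightharpoonup> \<rho> \<rightharpoonup> \<tau>) \<rightharpoonup> (snd x \<rightharpoonup> \<rho>) \<rightharpoonup> snd x \<rightharpoonup> \<tau>)"
      using con_in_D[of "cSig (snd x) \<rho> \<tau>"] by simp
    have "eqv M \<tau> (?s \<bullet> d \<bullet> (?t \<bullet> d)) (ev M s ?e \<bullet> ev M t ?e)"
    proof (rule app_eqv)
      show "eqv M (\<rho> \<rightharpoonup> \<tau>) (?s \<bullet> d) (ev M s ?e)" by (rule App.IH(1)[OF s])
      show "eqv M \<rho> (?t \<bullet> d) (ev M t ?e)" by (rule App.IH(2)[OF t])
      show "?s \<bullet> d \<in> D (\<rho> \<rightharpoonup> \<tau>)" "?t \<bullet> d \<in> D \<rho>"
        using sD tD assms(2) by auto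
      show "ev M s ?e \<in> D (\<rho> \<rightharpoonup> \<tau>)" "ev M t ?e \<in> D \<rho>"
        using ev_in_D[OF e] s t by auto
    qed
    moreover have "eqv M \<tau> (Con M (cSig (snd x) \<rho> \<tau>) \<bullet> ?s \<bullet> ?t \<bullet> d) (?s \<bullet> d \<bullet> (?t \<bullet> d))"
      by (rule Sig_eqv[OF sD tD assms(2)])
    moreover have "Con M (cSig (snd x) \<rho> \<tau>) \<bullet> ?s \<bullet> ?t \<bullet> d \<in> D \<tau>"
      using app_in_D[OF app_in_D[OF app_in_D[OF S sD] tD] assms(2)] .
    moreover have "?s \<bullet> d \<bullet> (?t \<bullet> d) \<in> D \<tau>"
      using app_in_D[OF app_in_D[OF sD assms(2)] app_in_D[OF tD assms(2)]] .
    moreover have "ev M s ?e \<bullet> ev M t ?e \<in> D \<tau>"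
      using ev_in_D[OF e st] by simp
    ultimately have "eqv M \<tau> (Con M (cSig (snd x) \<rho> \<tau>) \<bullet> ?s \<bullet> ?t \<bullet> d) (ev M s ?e \<bullet> ev M t ?e)"
      by (blast intro: eqv_trans)
    moreover have "lam x (s \<cdot> t) = C (cSig (snd x) \<rho> \<tau>) \<cdot> lam x s \<cdot> lam x t"
      using True s t by (simp add: Let_def del: fvt.simps)
    ultimately show ?thesis by (simp only: ev.simps)
  next
    case False
    have "eqv M \<tau> (Con M (cPi \<tau> (snd x)) \<bullet> ev M (s \<cdot> t) e \<bullet> d) (ev M (s \<cdot> t) e)"
      by (rule Pi_eqv[OF ev_in_D[OF assms(1) st] assms(2)])
    moreover have "ev M (s \<cdot> t) (e(x := d)) = ev M (s \<cdot> t) e"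
      using False by (rule ev_update_fresh)
    moreover have "lam x (s \<cdot> t) = C (cPi \<tau> (snd x)) \<cdot> (s \<cdot> t)"
      using False s t by (simp add: Let_def del: fvt.simps)
    ultimately show ?thesis by (simp only: ev.simps)
  qed
qed

end

section \<open>Arithmetical formulas as equations with the number zero\<close>

abbreviation mm :: var where "mm \<equiv> (0, (N \<rightharpoonup> N) \<rightharpoonup> N)"
abbreviation dd :: var where
  "dd \<equiv> (0, (N \<rightharpoonup> N) \<rightharpoonup> (N \<rightharpoonup> N) \<rightharpoonup> (N \<rightharpoonup> N) \<rightharpoonup> (N \<rightharpoonup> N) \<rightharpoonup> N)"

text \<open>\<open>mm\<close> maps a function with a zero to a zero of it. \<open>dd\<close> reads its four arguments \<open>f, g, h, k\<close> at \<open>0\<close>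
  and decides the negation of \<open>f 0 = g 0 \<and> h 0 \<le> k 0\<close>. This one functional covers both
  atomic formulas and, through negated conjunction, all connectives. Numbers are passed as constant
  functions because \<open>QF-AC\<^sup>1\<^sup>,\<^sup>0\<close> yields functionals of type \<open>1\<close> arguments.\<close>

definition operators_fm :: fm where
  "operators_fm =
    Forall vX (Forall nn (Eq (V vX \<cdot> V nn) tzero \<^bold>\<longrightarrow> Eq (V vX \<cdot> (V mm \<cdot> V vX)) tzero)) \<^bold>\<and>
    Forall vX (Forall vF (Forall vY (Forall vG
      (Eq (V dd \<cdot> V vX \<cdot> V vF \<cdot> V vY \<cdot> V vG) tzero \<^bold>\<longleftrightarrow>
       \<^bold>\<not> (Eq (V vX \<cdot> tzero) (V vF \<cdot> tzero) \<^bold>\<and> Le (V vY \<cdot> tzero) (V vG \<cdot> tzero))))))"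

abbreviation const_tm :: "tm \<Rightarrow> tm" where "const_tm t \<equiv> C (cPi N N) \<cdot> t"

definition nand_tm :: "tm \<Rightarrow> tm \<Rightarrow> tm \<Rightarrow> tm \<Rightarrow> tm" where
  "nand_tm s t u v = V dd \<cdot> const_tm s \<cdot> const_tm t \<cdot> const_tm u \<cdot> const_tm v"

definition not_tm :: "tm \<Rightarrow> tm" where "not_tm t = nand_tm t tzero tzero tzero"

text \<open>If \<open>t\<close> is zero for some value of \<open>x\<close>, then it is zero at the value that \<open>mm\<close> finds for \<open>\<lambda>x. t\<close>.\<close>

definition some_tm :: "var \<Rightarrow> tm \<Rightarrow> tm" where
  "some_tm x t = lam x t \<cdot> (V mm \<cdot> lam x t)"

text \<open>The number zero represents truth. Nonarithmetical formulas receive a dummy term.\<close>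

primrec char_tm :: "fm \<Rightarrow> tm" where
  "char_tm (Eq s t) = not_tm (nand_tm s t tzero tzero)"
| "char_tm (Le s t) = not_tm (nand_tm tzero tzero s t)"
| "char_tm (St \<sigma> t) = tzero"
| "char_tm Bot = tone"
| "char_tm (\<phi> \<^bold>\<longrightarrow> \<psi>) = nand_tm (char_tm \<phi>) tzero (not_tm (char_tm \<psi>)) tzero"
| "char_tm (\<phi> \<^bold>\<and> \<psi>) = not_tm (nand_tm (char_tm \<phi>) tzero (char_tm \<psi>) tzero)"
| "char_tm (\<phi> \<^bold>\<or> \<psi>) = nand_tm (not_tm (char_tm \<phi>)) tzero (not_tm (char_tm \<psi>)) tzero"
| "char_tm (Forall x \<phi>) = not_tm (some_tm x (not_tm (char_tm \<phi>)))"
| "char_tm (Exists x \<phi>) = some_tm x (char_tm \<phi>)"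
| "char_tm (ForallSt x \<phi>) = tzero"
| "char_tm (ExistsSt x \<phi>) = tzero"

primrec arith :: "fm \<Rightarrow> bool" where
  "arith (Eq s t) = True"
| "arith (Le s t) = True"
| "arith (St \<sigma> t) = False"
| "arith Bot = True"
| "arith (\<phi> \<^bold>\<longrightarrow> \<psi>) = (arith \<phi> \<and> arith \<psi>)"
| "arith (\<phi> \<^bold>\<and> \<psi>) = (arith \<phi> \<and> arith \<psi>)"
| "arith (\<phi> \<^bold>\<or> \<psi>) = (arith \<phi> \<and> arith \<psi>)"
| "arith (Forall x \<phi>) = (snd x = N \<and> arith \<phi>)"
| "arith (Exists x \<phi>) = (snd x = N \<and> arith \<phi>)"
| "arith (ForallSt x \<phi>) = False"
| "arith (ExistsSt x \<phi>) = False"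

lemma tyof_nand_tm [simp]:
  "tyof s = Some N \<Longrightarrow> tyof t = Some N \<Longrightarrow> tyof u = Some N \<Longrightarrow> tyof v = Some N \<Longrightarrow>
    tyof (nand_tm s t u v) = Some N"
  by (simp add: nand_tm_def)

lemma tyof_not_tm [simp]: "tyof t = Some N \<Longrightarrow> tyof (not_tm t) = Some N"
  by (simp add: not_tm_def)

lemma tyof_some_tm [simp]: "tyof t = Some N \<Longrightarrow> snd x = N \<Longrightarrow> tyof (some_tm x t) = Some N"
  by (simp add: some_tm_def)

lemma fvt_nand_tm [simp]: "fvt (nand_tm s t u v) = {dd} \<union> fvt s \<union> fvt t \<union> fvt u \<union> fvt v"
  by (auto simp: nand_tm_def)

lemma fvt_not_tm [simp]: "fvt (not_tm t) = {dd} \<union> fvt t"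
  by (simp add: not_tm_def)

lemma fvt_some_tm [simp]: "fvt (some_tm x t) = {mm} \<union> (fvt t - {x})"
  by (auto simp: some_tm_def)

lemma tyof_char_tm [simp]: "wff \<phi> \<Longrightarrow> arith \<phi> \<Longrightarrow> tyof (char_tm \<phi>) = Some N"
  by (induction \<phi>) simp_all

lemma fvt_char_tm: "fvt (char_tm \<phi>) \<subseteq> fv \<phi> \<union> {mm, dd}"
  by (induction \<phi>) auto

lemma internal_arith: "arith \<phi> \<Longrightarrow> internal \<phi>"
  by (induction \<phi>) auto

context model
begin

definition good_env :: "(var \<Rightarrow> 'd) \<Rightarrow> bool" where
  "good_env e \<longleftrightarrow> typed_env M e \<and> sem M operators_fm e"

lemma good_typed: "good_env e \<Longrightarrow> typed_env M e"
  by (simp add: good_env_def)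

lemma good_cong: "good_env e \<Longrightarrow> typed_env M e' \<Longrightarrow> e' mm = e mm \<Longrightarrow> e' dd = e dd \<Longrightarrow> good_env e'"
proof -
  assume "good_env e" "typed_env M e'" and eq: "e' mm = e mm" "e' dd = e dd"
  moreover have "sem M operators_fm e' = sem M operators_fm e"
    by (rule sem_cong) (use eq in \<open>auto simp: operators_fm_def\<close>)
  ultimately show ?thesis by (simp add: good_env_def)
qed

lemma good_update: "good_env e \<Longrightarrow> d \<in> D (snd x) \<Longrightarrow> x \<noteq> mm \<Longrightarrow> x \<noteq> dd \<Longrightarrow> good_env (e(x := d))"
  by (rule good_cong) (auto simp: good_typed)

lemma good_update_N: "good_env e \<Longrightarrow> snd x = N \<Longrightarrow> d \<in> D N \<Longrightarrow> good_env (e(x := d))"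
  by (rule good_update) auto

lemma good_mu:
  assumes "good_env e" "f \<in> D (N \<rightharpoonup> N)" "a \<in> D N" "f \<bullet> a \<approx> \<zero>"
  shows "f \<bullet> (e mm \<bullet> f) \<approx> \<zero>"
proof -
  have "\<forall>f \<in> D (N \<rightharpoonup> N). \<forall>a \<in> D N. f \<bullet> a \<approx> \<zero> \<longrightarrow> f \<bullet> (e mm \<bullet> f) \<approx> \<zero>"
    using assms(1) by (simp add: good_env_def operators_fm_def)
  then show ?thesis using assms by blast
qed

lemma good_nand:
  assumes "good_env e"
    and "f \<in> D (N \<rightharpoonup> N)" "g \<in> D (N \<rightharpoonup> N)" "h \<in> D (N \<rightharpoonup> N)" "k \<in> D (N \<rightharpoonup> N)"
  shows "e dd \<bullet> f \<bullet> g \<bullet> h \<bullet> k \<approx> \<zero> \<longleftrightarrow>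
    \<not> (f \<bullet> \<zero> \<approx> g \<bullet> \<zero> \<and> LeR M (h \<bullet> \<zero>) (k \<bullet> \<zero>))"
proof -
  have "sem M operators_fm e" using assms(1) by (simp add: good_env_def)
  note this[unfolded operators_fm_def sem.simps snd_conv, THEN conjunct2, THEN bspec,
      OF assms(2), THEN bspec, OF assms(3), THEN bspec, OF assms(4), THEN bspec, OF assms(5)]
  then show ?thesis by auto
qed

lemma nand_tm_zero:
  assumes e: "good_env e"
    and t: "tyof s = Some N" "tyof t = Some N" "tyof u = Some N" "tyof v = Some N"
  shows "ev M (nand_tm s t u v) e \<approx> \<zero> \<longleftrightarrow>
    \<not> (ev M s e \<approx> ev M t e \<and> LeR M (ev M u e) (ev M v e))"
proof -
  have P: "ev M r e \<in> D N \<and> ev M (const_tm r) e \<in> D (N \<rightharpoonup> N) \<and> ev M (const_tm r) e \<bullet> \<zero> \<in> D N \<and>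
      ev M (const_tm r) e \<bullet> \<zero> \<approx> ev M r e \<and> ev M r e \<approx> ev M (const_tm r) e \<bullet> \<zero>"
    if "tyof r = Some N" for r
  proof -
    have r: "ev M r e \<in> D N" by (rule ev_in_D[OF good_typed[OF e] that])
    have c: "ev M (const_tm r) e \<in> D (N \<rightharpoonup> N)"
      by (rule ev_in_D[OF good_typed[OF e]]) (simp add: that)
    have "ev M (const_tm r) e \<bullet> \<zero> \<approx> ev M r e"
      using Pi_eqv[OF r zero_in_D] by simp
    moreover have "ev M (const_tm r) e \<bullet> \<zero> \<in> D N" using c by simp
    ultimately show ?thesis using r c eq0_sym by blast
  qed
  have "ev M (nand_tm s t u v) e \<approx> \<zero> \<longleftrightarrow>
      \<not> (ev M (const_tm s) e \<bullet> \<zero> \<approx> ev M (const_tm t) e \<bullet> \<zero> \<and>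
        LeR M (ev M (const_tm u) e \<bullet> \<zero>) (ev M (const_tm v) e \<bullet> \<zero>))"
    using good_nand[OF e, of "ev M (const_tm s) e" "ev M (const_tm t) e"
        "ev M (const_tm u) e" "ev M (const_tm v) e"]
      P[OF t(1)] P[OF t(2)] P[OF t(3)] P[OF t(4)]
    by (simp add: nand_tm_def)
  moreover have "ev M (const_tm s) e \<bullet> \<zero> \<approx> ev M (const_tm t) e \<bullet> \<zero> \<longleftrightarrow> ev M s e \<approx> ev M t e"
    using P[OF t(1)] P[OF t(2)] by (meson eq0_trans)
  moreover have "LeR M (ev M (const_tm u) e \<bullet> \<zero>) (ev M (const_tm v) e \<bullet> \<zero>) \<longleftrightarrow>
      LeR M (ev M u e) (ev M v e)"
    using P[OF t(3)] P[OF t(4)] by (meson le_congI)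
  ultimately show ?thesis by simp
qed

text \<open>With second and fourth argument zero, the atomic conditions become \<open>s = 0\<close> and \<open>t \<le> 0\<close>, so that
  the same functional negates the conjunction of two truth values.\<close>

lemma nand_tm_zero_zero:
  assumes e: "good_env e" and "tyof s = Some N" "tyof t = Some N"
  shows "ev M (nand_tm s tzero t tzero) e \<approx> \<zero> \<longleftrightarrow> \<not> (ev M s e \<approx> \<zero> \<and> ev M t e \<approx> \<zero>)"
  using assms ev_in_D[OF good_typed[OF e]] by (simp add: nand_tm_zero le_zero_iff)

lemma not_tm_zero:
  "good_env e \<Longrightarrow> tyof t = Some N \<Longrightarrow> ev M (not_tm t) e \<approx> \<zero> \<longleftrightarrow> \<not> ev M t e \<approx> \<zero>"
  by (simp add: not_tm_def nand_tm_zero_zero)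

text \<open>The second part keeps track of the witness; transfer needs to know that it is the value of a term.\<close>

lemma some_tm_zero:
  assumes e: "good_env e" and t: "tyof t = Some N" and x: "snd x = N"
  shows "ev M (some_tm x t) e \<approx> \<zero> \<longleftrightarrow> (\<exists>d \<in> D N. ev M t (e(x := d)) \<approx> \<zero>)"
    and "ev M (some_tm x t) e \<approx> \<zero> \<Longrightarrow> ev M t (e(x := ev M (V mm \<cdot> lam x t) e)) \<approx> \<zero>"
proof -
  let ?F = "ev M (lam x t) e" and ?m = "ev M (V mm \<cdot> lam x t) e"
  have F: "?F \<in> D (N \<rightharpoonup> N)" and m: "?m \<in> D N"
    by (rule ev_in_D[OF good_typed[OF e]]; simp add: t x)+
  have beta: "?F \<bullet> d \<approx> \<zero> \<longleftrightarrow> ev M t (e(x := d)) \<approx> \<zero>" if d: "d \<in> D N" for d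
  proof -
    have 1: "?F \<bullet> d \<approx> ev M t (e(x := d))"
      using lam_beta[OF good_typed[OF e] _ t, of d x] d x by simp
    have 2: "ev M t (e(x := d)) \<in> D N"
      by (rule ev_in_D[OF _ t]) (use good_typed[OF e] d x in simp)
    show ?thesis by (rule eq0_cong[OF app_in_D[OF F d] 2 zero_in_D 1])
  qed
  have mu: "?F \<bullet> d \<approx> \<zero> \<Longrightarrow> ?F \<bullet> ?m \<approx> \<zero>" if "d \<in> D N" for d
    using good_mu[OF e F that] by simp
  show "ev M (some_tm x t) e \<approx> \<zero> \<longleftrightarrow> (\<exists>d \<in> D N. ev M t (e(x := d)) \<approx> \<zero>)"
    using beta mu m by (auto simp: some_tm_def)
  show "ev M (some_tm x t) e \<approx> \<zero> \<Longrightarrow> ev M t (e(x := ?m)) \<approx> \<zero>"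
    using beta[OF m] by (simp add: some_tm_def)
qed

lemma char_tm_zero:
  "good_env e \<Longrightarrow> wff \<phi> \<Longrightarrow> arith \<phi> \<Longrightarrow> ev M (char_tm \<phi>) e \<approx> \<zero> \<longleftrightarrow> sem M \<phi> e"
proof (induction \<phi> arbitrary: e)
  case (Forall x \<phi>)
  then have "ev M (char_tm \<phi>) (e(x := d)) \<approx> \<zero> \<longleftrightarrow> sem M \<phi> (e(x := d))" "good_env (e(x := d))"
    if "d \<in> D N" for d
    using that good_update_N[of e x d] by simp_all
  then show ?case using Forall.prems by (simp add: not_tm_zero some_tm_zero(1))
next
  case (Exists x \<phi>)
  then have "ev M (char_tm \<phi>) (e(x := d)) \<approx> \<zero> \<longleftrightarrow> sem M \<phi> (e(x := d))"
    if "d \<in> D N" for d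
    using that good_update_N[of e x d] by simp
  then show ?case using Exists.prems by (simp add: some_tm_zero(1))
next
  case (Eq s t)
  then show ?case by (simp add: nand_tm_zero not_tm_zero le_zero_iff)
next
  case (Le s t)
  then show ?case by (simp add: nand_tm_zero not_tm_zero)
qed (simp_all add: nand_tm_zero_zero not_tm_zero one_neq_zero)

section \<open>Transfer of arithmetical formulas\<close>

lemma Std_app:
  "Std (\<sigma> \<rightharpoonup> \<tau>) a \<Longrightarrow> Std \<sigma> b \<Longrightarrow> a \<in> D (\<sigma> \<rightharpoonup> \<tau>) \<Longrightarrow> b \<in> D \<sigma> \<Longrightarrow> Std \<tau> (a \<bullet> b)"
  using ST_sem[OF ST.st_app, of \<sigma> \<tau> "e0((0, \<sigma> \<rightharpoonup> \<tau>) := a, (1, \<sigma>) := b)"] by simp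

lemma Std_le: "Std N a \<Longrightarrow> LeR M b a \<Longrightarrow> a \<in> D N \<Longrightarrow> b \<in> D N \<Longrightarrow> Std N b"
  using ST_sem[OF ST.st_le, of "e0(nn := a, kk := b)"] by simp

lemma Std_ev:
  assumes e: "typed_env M e"
  shows "tyof t = Some \<tau> \<Longrightarrow> (\<And>x. x \<in> fvt t \<Longrightarrow> Std (snd x) (e x)) \<Longrightarrow> Std \<tau> (ev M t e)"
proof (induction t arbitrary: \<tau>)
  case (C c)
  then show ?case using ST_sem[OF ST.st_closed, of "C c" \<tau> e0] by simp
next
  case (App s t)
  obtain \<rho> where s: "tyof s = Some (\<rho> \<rightharpoonup> \<tau>)" and t: "tyof t = Some \<rho>"
    using App.prems(1) by (rule tyof_AppE)
  have "Std (\<rho> \<rightharpoonup> \<tau>) (ev M s e)" "Std \<rho> (ev M t e)"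
    using App.IH(1)[OF s] App.IH(2)[OF t] App.prems(2) by auto
  then show ?case using Std_app ev_in_D[OF e s] ev_in_D[OF e t] by simp
qed (use assms in auto)

text \<open>The environments to which transfer applies: besides the parameters in \<open>A\<close>, the two operators have
  to be standard, since they occur in the terms representing arithmetical formulas.\<close>

definition std_env :: "(var \<Rightarrow> 'd) \<Rightarrow> var set \<Rightarrow> bool" where
  "std_env e A \<longleftrightarrow> good_env e \<and> Std (snd mm) (e mm) \<and> Std (snd dd) (e dd) \<and>
     (\<forall>x \<in> A. Std (snd x) (e x))"

text \<open>The witness is the value of \<open>mm \<cdot> (\<lambda>x. t)\<close>, where \<open>t = 0\<close> represents \<open>\<phi>\<close>. All variables of this
  term denote standard objects, hence so does the term.\<close>

lemma standard_witness:
  assumes e: "std_env e (fv (Exists x \<phi>))" and \<phi>: "wff \<phi>" "arith \<phi>" "snd x = N"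
    and ex: "sem M (Exists x \<phi>) e"
  shows "\<exists>d \<in> D N. Std N d \<and> sem M \<phi> (e(x := d))"
proof -
  have good: "good_env e" using e by (simp add: std_env_def)
  let ?t = "V mm \<cdot> lam x (char_tm \<phi>)"
  let ?d = "ev M ?t e"
  have ty: "tyof ?t = Some N" using \<phi> by simp
  have d: "?d \<in> D N" by (rule ev_in_D[OF good_typed[OF good] ty])
  have "ev M (char_tm (Exists x \<phi>)) e \<approx> \<zero>"
    using char_tm_zero[OF good, of "Exists x \<phi>"] \<phi> ex by simp
  then have "ev M (char_tm \<phi>) (e(x := ?d)) \<approx> \<zero>"
    using some_tm_zero(2)[OF good _ \<phi>(3)] \<phi> by simp
  moreover have "good_env (e(x := ?d))"
    by (rule good_update_N[OF good \<phi>(3) d])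
  ultimately have "sem M \<phi> (e(x := ?d))" using char_tm_zero \<phi> by blast
  moreover have "Std N ?d"
  proof (rule Std_ev[OF good_typed[OF good] ty])
    fix z assume "z \<in> fvt ?t"
    then have "z = mm \<or> z = dd \<or> z \<in> fv (Exists x \<phi>)" using fvt_char_tm[of \<phi>] by auto
    then show "Std (snd z) (e z)" using e by (auto simp: std_env_def)
  qed
  ultimately show ?thesis using d by blast
qed

text \<open>Numbers below a standard number are standard. This is why the relativisation may leave bounded
  quantifiers unchanged.\<close>

lemma bounded_standard:
  assumes e: "std_env e (fv (Exists x \<beta>))" and \<beta>: "wff \<beta>" "bounded_by x \<beta>"
    and d: "d \<in> D N" "sem M \<beta> (e(x := d))" and x: "snd x = N"
  shows "Std N d"
proof -
  have te: "typed_env M e" using e good_typed by (simp add: std_env_def)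
  obtain t where t: "x \<notin> fvt t" "\<beta> = Le (V x) t \<or> \<beta> = Less (V x) t"
    using \<beta>(2) by (auto simp: bounded_by_def)
  have ty: "tyof t = Some N" using t(2) \<beta>(1) by auto
  have tD: "ev M t e \<in> D N" by (rule ev_in_D[OF te ty])
  have "Std N (ev M t e)"
    by (rule Std_ev[OF te ty]) (use e t in \<open>auto simp: std_env_def\<close>)
  moreover have "LeR M d (ev M t e) \<or> LeR M (Con M cSucc \<bullet> d) (ev M t e)"
    using t d(2) by auto
  ultimately show ?thesis
    using Std_le[OF _ _ tD] Std_le[OF _ le_suc_self] d(1) suc_in_D by blast
qed

lemma relst_bound: "bounded_by x \<beta> \<Longrightarrow> relst \<beta> = \<beta>"
  by (auto simp: bounded_by_def)

lemma std_env_mono: "std_env e A \<Longrightarrow> B \<subseteq> A \<Longrightarrow> std_env e B"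
  by (auto simp: std_env_def)

text \<open>A quantifier may be restricted to standard numbers because witnesses, and counterexamples as
  witnesses of the negation, can be chosen standard.\<close>

lemma transfer:
  "std_env e (fv \<phi>) \<Longrightarrow> wff \<phi> \<Longrightarrow> arith \<phi> \<Longrightarrow> sem M (relst \<phi>) e = sem M \<phi> e"
proof (induction \<phi> arbitrary: e)
  case (Imp \<phi> \<psi>)
  then show ?case using std_env_mono[of e _ "fv \<phi>"] std_env_mono[of e _ "fv \<psi>"] by simp
next
  case (Conj \<phi> \<psi>)
  then show ?case using std_env_mono[of e _ "fv \<phi>"] std_env_mono[of e _ "fv \<psi>"] by simp
next
  case (Disj \<phi> \<psi>)
  then show ?case using std_env_mono[of e _ "fv \<phi>"] std_env_mono[of e _ "fv \<psi>"] by simp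
next
  case (Forall x \<phi>)
  have x: "snd x = N" using Forall.prems by simp
  have IH: "sem M (relst \<phi>) (e(x := d)) = sem M \<phi> (e(x := d))" if d: "d \<in> D N" "Std N d" for d
  proof (rule Forall.IH)
    show "std_env (e(x := d)) (fv \<phi>)"
      using Forall.prems(1) d x good_update_N[of e x d] by (auto simp: std_env_def)
  qed (use Forall.prems in auto)
  have all: "sem M (Forall x \<phi>) e \<longleftrightarrow> (\<forall>d \<in> D N. Std N d \<longrightarrow> sem M \<phi> (e(x := d)))"
    using standard_witness[of e x "\<^bold>\<not> \<phi>"] Forall.prems by auto
  show ?case
  proof (cases "\<exists>\<beta> \<psi>. \<phi> = (\<beta> \<^bold>\<longrightarrow> \<psi>) \<and> bounded_by x \<beta>")
    case True
    then obtain \<beta> \<psi> where b: "\<phi> = (\<beta> \<^bold>\<longrightarrow> \<psi>)" "bounded_by x \<beta>" by blast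
    have "Std N d" if "d \<in> D N" "sem M \<beta> (e(x := d))" for d
    proof (rule bounded_standard[OF _ _ b(2) that x])
      show "std_env e (fv (Exists x \<beta>))"
        by (rule std_env_mono[OF Forall.prems(1)]) (use b(1) in auto)
    qed (use b Forall.prems in auto)
    moreover have "relst \<phi> = (\<beta> \<^bold>\<longrightarrow> relst \<psi>)" using b relst_bound by simp
    \<comment> \<open>At nonstandard numbers the bound fails, so the implication below the quantifier holds vacuously.\<close>
    ultimately have "sem M (relst \<phi>) (e(x := d))" if "d \<in> D N" "\<not> Std N d" for d
      using that by auto
    then show ?thesis using True all IH x by auto
  next
    case False
    then show ?thesis using all IH x by auto
  qed
next
  case (Exists x \<phi>)
  have x: "snd x = N" using Exists.prems by simp
  have IH: "sem M (relst \<phi>) (e(x := d)) = sem M \<phi> (e(x := d))" if d: "d \<in> D N" "Std N d" for d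
  proof (rule Exists.IH)
    show "std_env (e(x := d)) (fv \<phi>)"
      using Exists.prems(1) d x good_update_N[of e x d] by (auto simp: std_env_def)
  qed (use Exists.prems in auto)
  have ex: "sem M (Exists x \<phi>) e \<longleftrightarrow> (\<exists>d \<in> D N. Std N d \<and> sem M \<phi> (e(x := d)))"
    using standard_witness[of e x \<phi>] Exists.prems by auto
  show ?case
  proof (cases "\<exists>\<beta> \<psi>. \<phi> = (\<beta> \<^bold>\<and> \<psi>) \<and> bounded_by x \<beta>")
    case True
    then obtain \<beta> \<psi> where b: "\<phi> = (\<beta> \<^bold>\<and> \<psi>)" "bounded_by x \<beta>" by blast
    have "Std N d" if "d \<in> D N" "sem M \<beta> (e(x := d))" for d
    proof (rule bounded_standard[OF _ _ b(2) that x])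
      show "std_env e (fv (Exists x \<beta>))"
        by (rule std_env_mono[OF Exists.prems(1)]) (use b(1) in auto)
    qed (use b Exists.prems in auto)
    moreover have "relst \<phi> = (\<beta> \<^bold>\<and> relst \<psi>)" using b relst_bound by simp
    ultimately have "Std N d" if "d \<in> D N" "sem M (relst \<phi>) (e(x := d))" for d
      using that by auto
    then show ?thesis using True ex IH x by auto
  next
    case False
    then show ?thesis using ex IH x by auto
  qed
qed simp_all

end

section \<open>The formulas of arithmetical transfinite recursion\<close>

lemma tyof_lam_the [simp]:
  "tyof t \<noteq> None \<Longrightarrow> tyof (lam x t) = Some (snd x \<rightharpoonup> the (tyof t))"
  by auto

lemma tyof_brec [simp]:
  "tyof t = Some N \<Longrightarrow> tyof s = Some N \<Longrightarrow> tyof u = Some N \<Longrightarrow> tyof v = Some N \<Longrightarrow>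
    tyof (brec t s u v) = Some N"
  by (simp add: brec_def)

lemma fvt_brec [simp]:
  "fvt (brec t s u v) = fvt t \<union> fvt s \<union> (fvt u - {rr, kk}) \<union> (fvt v - {kk})"
  by (auto simp: brec_def)

lemma pred_tm_typing [simp]: "tyof pred_tm = Some (N \<rightharpoonup> N)" "fvt pred_tm = {}"
  by (simp_all add: pred_tm_def)

lemma monus_tm_typing [simp]: "tyof monus_tm = Some (N \<rightharpoonup> N \<rightharpoonup> N)" "fvt monus_tm = {}"
  by (auto simp: monus_tm_def)

lemma isz_typing [simp]:
  "tyof t = Some N \<Longrightarrow> tyof (isz t) = Some N" "fvt (isz t) = fvt t"
  by (simp_all add: isz_def)

lemma eqc_typing [simp]:
  "tyof s = Some N \<Longrightarrow> tyof t = Some N \<Longrightarrow> tyof (eqc s t) = Some N"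
  "fvt (eqc s t) = fvt s \<union> fvt t"
  by (auto simp: eqc_def)

lemma mod2_tm_typing [simp]: "tyof mod2_tm = Some (N \<rightharpoonup> N)" "fvt mod2_tm = {}"
  by (simp_all add: mod2_tm_def)

lemma half_tm_typing [simp]: "tyof half_tm = Some (N \<rightharpoonup> N)" "fvt half_tm = {}"
  by (simp_all add: half_tm_def)

lemma shift_tm_typing [simp]: "tyof shift_tm = Some (N \<rightharpoonup> N \<rightharpoonup> N)" "fvt shift_tm = {}"
  by (auto simp: shift_tm_def)

lemma blen_tm_typing [simp]: "tyof blen_tm = Some (N \<rightharpoonup> N)" "fvt blen_tm = {}"
  by (auto simp: blen_tm_def)

lemma cat0_tm_typing [simp]: "tyof cat0_tm = Some (N \<rightharpoonup> N \<rightharpoonup> N)" "fvt cat0_tm = {}"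
  by (auto simp: cat0_tm_def)

lemma bar_tm_typing [simp]: "tyof bar_tm = Some ((N \<rightharpoonup> N) \<rightharpoonup> N \<rightharpoonup> N)" "fvt bar_tm = {}"
  by (auto simp: bar_tm_def Let_def)

lemma pair_typing [simp]:
  "tyof s = Some N \<Longrightarrow> tyof t = Some N \<Longrightarrow> tyof (pair s t) = Some N"
  "fvt (pair s t) = fvt s \<union> fvt t"
  by (auto simp: pair_def)

lemma cut_tm_typing [simp]:
  "tyof cut_tm = Some ((N \<rightharpoonup> N) \<rightharpoonup> (N \<rightharpoonup> N) \<rightharpoonup> N \<rightharpoonup> N \<rightharpoonup> N)" "fvt cut_tm = {}"
  by (auto simp: cut_tm_def)

definition descending :: fm where
  "descending = Forall nn (lessX (V vX) (V vG \<cdot> suc (V nn)) (V vG \<cdot> V nn))"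

lemmas order_defs = inset_def leX_def lessX_def fieldX_def

lemma LO_typing [simp]: "wff LO" "arith LO" "fv LO = {vX}"
  by (auto simp: LO_def Let_def order_defs)

lemma descending_typing [simp]: "wff descending" "arith descending" "fv descending = {vX, vG}"
  by (auto simp: descending_def order_defs)

lemma H_typing [simp]: "wff H" "arith H" "fv H = {vX, vF, vY}"
  by (auto simp: H_def theta_def Let_def order_defs)

lemma WO_eq: "WO = LO \<^bold>\<and> \<^bold>\<not> Exists vG descending"
  by (simp add: WO_def descending_def)

lemma relst_WO: "relst WO = relst LO \<^bold>\<and> \<^bold>\<not> ExistsSt vG (relst descending)"
proof -
  have "\<not> (\<exists>\<beta> \<psi>. descending = (\<beta> \<^bold>\<and> \<psi>) \<and> bounded_by vG \<beta>)" by (simp add: descending_def)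
  then show ?thesis by (simp add: WO_eq)
qed

lemma relst_ATR:
  "relst ATR = ForallSt vX (ForallSt vF (relst WO \<^bold>\<longrightarrow> ExistsSt vY (relst H)))"
proof -
  have "\<not> (\<exists>\<beta> \<psi>. H = (\<beta> \<^bold>\<and> \<psi>) \<and> bounded_by vY \<beta>)" by (simp add: H_def)
  moreover have "\<not> bounded_by vF WO" by (simp add: WO_eq bounded_by_def)
  ultimately show ?thesis by (simp add: ATR_def)
qed

lemma wff_relst: "wff (relst \<phi>) = wff \<phi>"
  by (induction \<phi>) auto

lemma fv_relst: "fv (relst \<phi>) = fv \<phi>"
  by (induction \<phi>) auto

lemma ATR_typing [simp]: "wff ATR" "fv ATR = {}"
  by (auto simp: ATR_def WO_eq)

text \<open>The arithmetical matrix of \<open>ATR\<close> once the descending sequence refuting \<open>WO\<close> has become a second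
  witness next to the iteration \<open>Y\<close>. Since the theory is classical, \<open>ATR\<close> says that witnesses
  \<open>Y, g\<close> exist for all \<open>X, f\<close>.\<close>

definition witnessed :: fm where "witnessed = LO \<^bold>\<longrightarrow> H \<^bold>\<or> descending"

lemma witnessed_typing [simp]:
  "wff witnessed" "arith witnessed" "fv witnessed = {vX, vF, vY, vG}"
  by (auto simp: witnessed_def)

lemma fv_psubst: "fv (psubst \<phi> \<theta>) \<subseteq> (\<Union>z \<in> fv \<phi>. fvt (\<theta> z))"
proof -
  have tm: "fvt (tsubst t \<theta>) \<subseteq> (\<Union>z \<in> fvt t. fvt (\<theta> z))" for t \<theta>
    by (induction t) auto
  have under_quantifier: "fv (psubst \<chi> (\<theta>(x := V y))) - {y} \<subseteq> (\<Union>z \<in> fv \<chi> - {x}. fvt (\<theta> z))"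
    if "fv (psubst \<chi> (\<theta>(x := V y))) \<subseteq> (\<Union>z \<in> fv \<chi>. fvt ((\<theta>(x := V y)) z))" for \<chi> \<theta> x y
    using that by (fastforce split: if_splits)
  show ?thesis
  proof (induction \<phi> arbitrary: \<theta>)
    case (Forall x \<phi>)
    then show ?case unfolding psubst.simps Let_def fv.simps by (intro under_quantifier)
  next
    case (Exists x \<phi>)
    then show ?case unfolding psubst.simps Let_def fv.simps by (intro under_quantifier)
  next
    case (ForallSt x \<phi>)
    then show ?case unfolding psubst.simps Let_def fv.simps by (intro under_quantifier)
  next
    case (ExistsSt x \<phi>)
    then show ?case unfolding psubst.simps Let_def fv.simps by (intro under_quantifier)
  next
    case (Imp \<phi> \<psi>)
    show ?case using Imp.IH[of \<theta>] by auto
  next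
    case (Conj \<phi> \<psi>)
    show ?case using Conj.IH[of \<theta>] by auto
  next
    case (Disj \<phi> \<psi>)
    show ?case using Disj.IH[of \<theta>] by auto
  qed (use tm in \<open>simp_all, blast+\<close>)
qed

lemma internal_psubst: "internal (psubst \<phi> \<theta>) = internal \<phi>"
  by (induction \<phi> arbitrary: \<theta>) (simp_all add: Let_def)

section \<open>Standard search operators\<close>

context model
begin

text \<open>The contrapositive of \<open>PF-TP\<close> for two variables. It serves to find standard operators and standard
  witness functionals, and a standard counterexample to \<open>ATR\<close>.\<close>

lemma standard_pair:
  assumes \<phi>: "wff \<phi>" "internal \<phi>" "fv \<phi> \<subseteq> {x, y}" and e: "typed_env M e"
    and ab: "a \<in> D (snd x)" "b \<in> D (snd y)" "sem M \<phi> (e(x := a, y := b))"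
  obtains a' b' where "a' \<in> D (snd x)" "b' \<in> D (snd y)" "Std (snd x) a'" "Std (snd y) b'"
    "sem M \<phi> (e(x := a', y := b'))"
proof -
  have "foldr ForallSt [x, y] (\<^bold>\<not> \<phi>) \<^bold>\<longrightarrow> foldr Forall [x, y] (\<^bold>\<not> \<phi>) \<in> PF_TP"
    by (rule PF_TP.intros) (use \<phi> in auto)
  then have "ForallSt x (ForallSt y (\<^bold>\<not> \<phi>)) \<^bold>\<longrightarrow> Forall x (Forall y (\<^bold>\<not> \<phi>)) \<in> theory_ATR"
    by (simp add: B0_def)
  from axiom_sem[OF this _ e] ab show ?thesis using \<phi>(1) that by auto
qed

text \<open>With the functional \<open>p\<close> of \<open>(\<exists>\<^sup>2)\<close> as a parameter, the matrix \<open>p f = 0 \<longrightarrow> f a = 0\<close> is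
  quantifier-free, and a number \<open>a\<close> exists for every \<open>f\<close>.\<close>

lemma mu_exists: "\<exists>m \<in> D (snd mm). \<forall>f \<in> D (N \<rightharpoonup> N). \<forall>a \<in> D N. f \<bullet> a \<approx> \<zero> \<longrightarrow> f \<bullet> (m \<bullet> f) \<approx> \<zero>"
proof -
  have "sem M exists2 e0" by (rule axiom_sem) (auto simp: exists2_def Let_def)
  then obtain p where p: "p \<in> D ((N \<rightharpoonup> N) \<rightharpoonup> N)"
    and p0: "\<And>f. f \<in> D (N \<rightharpoonup> N) \<Longrightarrow> p \<bullet> f \<approx> \<zero> \<longleftrightarrow> (\<exists>a \<in> D N. f \<bullet> a \<approx> \<zero>)"
    by (auto simp: exists2_def Let_def iff_conv_conj_imp)
  let ?Y = "(1, (N \<rightharpoonup> N) \<rightharpoonup> N) :: var"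
  let ?A = "Eq (V mm \<cdot> V vX) tzero \<^bold>\<longrightarrow> Eq (V vX \<cdot> V nn) tzero"
  let ?\<theta> = "V(nn := V ?Y \<cdot> V vX)"
  have "foldr Forall [vX] (foldr Exists [nn] ?A) \<^bold>\<longrightarrow>
      foldr Exists [?Y] (foldr Forall [vX] (psubst ?A ?\<theta>)) \<in> QF_AC 1 0"
    by (rule QF_AC.intros) (auto simp: fun_eq_iff)
  then have "Forall vX (Exists nn ?A) \<^bold>\<longrightarrow> Exists ?Y (Forall vX (psubst ?A ?\<theta>)) \<in> theory_ATR"
    by (simp add: B0_def)
  from axiom_sem[OF this, of "e0(mm := p)"] p
  \<comment> \<open>The instance of choice, read in the model with \<open>p\<close> as the value of \<open>mm\<close>.\<close>
  have ac: "(\<forall>f \<in> D (N \<rightharpoonup> N). \<exists>a \<in> D N. p \<bullet> f \<approx> \<zero> \<longrightarrow> f \<bullet> a \<approx> \<zero>) \<longrightarrow>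
      (\<exists>m \<in> D ((N \<rightharpoonup> N) \<rightharpoonup> N). \<forall>f \<in> D (N \<rightharpoonup> N). p \<bullet> f \<approx> \<zero> \<longrightarrow> f \<bullet> (m \<bullet> f) \<approx> \<zero>)"
    by simp
  have "\<forall>f \<in> D (N \<rightharpoonup> N). \<exists>a \<in> D N. p \<bullet> f \<approx> \<zero> \<longrightarrow> f \<bullet> a \<approx> \<zero>"
    using p0 zero_in_D by blast
  with ac obtain m where "m \<in> D ((N \<rightharpoonup> N) \<rightharpoonup> N)"
    "\<forall>f \<in> D (N \<rightharpoonup> N). p \<bullet> f \<approx> \<zero> \<longrightarrow> f \<bullet> (m \<bullet> f) \<approx> \<zero>"
    by blast
  then show ?thesis using p0 by auto
qed

text \<open>Classically the number \<open>0\<close> or the number \<open>1\<close> is the truth value of any condition; choice turns these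
  values into a functional when the condition is quantifier-free.\<close>

lemma nand_exists:
  "\<exists>d \<in> D (snd dd). \<forall>f \<in> D (N \<rightharpoonup> N). \<forall>g \<in> D (N \<rightharpoonup> N). \<forall>h \<in> D (N \<rightharpoonup> N). \<forall>k \<in> D (N \<rightharpoonup> N).
    d \<bullet> f \<bullet> g \<bullet> h \<bullet> k \<approx> \<zero> \<longleftrightarrow> \<not> (f \<bullet> \<zero> \<approx> g \<bullet> \<zero> \<and> LeR M (h \<bullet> \<zero>) (k \<bullet> \<zero>))"
proof -
  let ?B = "Eq (V vX \<cdot> tzero) (V vF \<cdot> tzero) \<^bold>\<and> Le (V vY \<cdot> tzero) (V vG \<cdot> tzero)"
  let ?A = "Eq (V nn) tzero \<^bold>\<longleftrightarrow> \<^bold>\<not> ?B"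
  let ?t = "V dd \<cdot> V vX \<cdot> V vF \<cdot> V vY \<cdot> V vG"
  let ?\<theta> = "V(nn := ?t)"
  have "foldr Forall [vX, vF, vY, vG] (foldr Exists [nn] ?A) \<^bold>\<longrightarrow>
      foldr Exists [dd] (foldr Forall [vX, vF, vY, vG] (psubst ?A ?\<theta>)) \<in> QF_AC 1 0"
    by (rule QF_AC.intros) (auto simp: fun_eq_iff)
  then have "Forall vX (Forall vF (Forall vY (Forall vG (Exists nn ?A)))) \<^bold>\<longrightarrow>
      Exists dd (Forall vX (Forall vF (Forall vY (Forall vG (Eq ?t tzero \<^bold>\<longleftrightarrow> \<^bold>\<not> ?B)))))
      \<in> theory_ATR"
    by (simp add: B0_def)
  from axiom_sem[OF this _ typed_e0]
  have "sem M (Forall vX (Forall vF (Forall vY (Forall vG (Exists nn ?A))))) e0 \<Longrightarrow>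
    sem M (Exists dd (Forall vX (Forall vF (Forall vY (Forall vG (Eq ?t tzero \<^bold>\<longleftrightarrow> \<^bold>\<not> ?B)))))) e0"
    by simp
  moreover have "sem M (Forall vX (Forall vF (Forall vY (Forall vG (Exists nn ?A))))) e0"
  proof -
    have "\<exists>a \<in> D N. a \<approx> \<zero> \<longleftrightarrow> P" for P
      using zero_in_D one_neq_zero suc_in_D[OF zero_in_D] eq0_refl[OF zero_in_D] by metis
    then show ?thesis by (simp flip: iff_conv_conj_imp)
  qed
  ultimately show ?thesis by (simp flip: iff_conv_conj_imp)
qed

lemma standard_operators:
  assumes e: "typed_env M e"
  obtains m d where "std_env (e(mm := m, dd := d)) {}"
proof -
  obtain m where m: "m \<in> D (snd mm)"
    "\<forall>f \<in> D (N \<rightharpoonup> N). \<forall>a \<in> D N. f \<bullet> a \<approx> \<zero> \<longrightarrow> f \<bullet> (m \<bullet> f) \<approx> \<zero>"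
    using mu_exists by blast
  obtain d where d: "d \<in> D (snd dd)"
    "\<forall>f \<in> D (N \<rightharpoonup> N). \<forall>g \<in> D (N \<rightharpoonup> N). \<forall>h \<in> D (N \<rightharpoonup> N). \<forall>k \<in> D (N \<rightharpoonup> N).
      d \<bullet> f \<bullet> g \<bullet> h \<bullet> k \<approx> \<zero> \<longleftrightarrow> \<not> (f \<bullet> \<zero> \<approx> g \<bullet> \<zero> \<and> LeR M (h \<bullet> \<zero>) (k \<bullet> \<zero>))"
    using nand_exists by blast
  have "sem M operators_fm (e(mm := m, dd := d))"
    using m(2) d(2) by (simp add: operators_fm_def flip: iff_conv_conj_imp)
  moreover have "wff operators_fm" "internal operators_fm" "fv operators_fm \<subseteq> {mm, dd}"
    by (auto simp: operators_fm_def)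
  ultimately obtain m' d' where "m' \<in> D (snd mm)" "d' \<in> D (snd dd)"
    "Std (snd mm) m'" "Std (snd dd) d'" "sem M operators_fm (e(mm := m', dd := d'))"
    using standard_pair[of operators_fm mm dd e m d] e m(1) d(1) by blast
  then have "std_env (e(mm := m', dd := d')) {}"
    using e by (simp add: std_env_def good_env_def)
  then show ?thesis by (rule that)
qed

section \<open>Arithmetical transfinite recursion and its relativisation\<close>

abbreviation witness_ty :: ty where "witness_ty \<equiv> (N \<rightharpoonup> N) \<rightharpoonup> (N \<rightharpoonup> N) \<rightharpoonup> N \<rightharpoonup> N"

text \<open>Replaces \<open>Y\<close> and \<open>g\<close> by the values at \<open>X, f\<close> of two functionals, denoted by variables.\<close>

definition witness_subst :: "var \<Rightarrow> tm" where
  "witness_subst = V(vY := V (4, witness_ty) \<cdot> V vX \<cdot> V vF,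
     vG := V (5, witness_ty) \<cdot> V vX \<cdot> V vF)"

definition linear :: "'d \<Rightarrow> bool" where
  "linear X \<longleftrightarrow> sem M LO (e0(vX := X))"

definition descends :: "'d \<Rightarrow> 'd \<Rightarrow> bool" where
  "descends X G \<longleftrightarrow> sem M descending (e0(vX := X, vG := G))"

definition iterates :: "'d \<Rightarrow> 'd \<Rightarrow> 'd \<Rightarrow> bool" where
  "iterates X F Y \<longleftrightarrow> sem M H (e0(vX := X, vF := F, vY := Y))"

lemma sem_LO: "sem M LO e \<longleftrightarrow> linear (e vX)"
  unfolding linear_def by (rule sem_cong) simp

lemma sem_descending: "sem M descending e \<longleftrightarrow> descends (e vX) (e vG)"
  unfolding descends_def by (rule sem_cong) auto

lemma sem_H: "sem M H e \<longleftrightarrow> iterates (e vX) (e vF) (e vY)"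
  unfolding iterates_def by (rule sem_cong) auto

lemma sem_witnessed:
  "sem M witnessed e \<longleftrightarrow>
    (linear (e vX) \<longrightarrow> iterates (e vX) (e vF) (e vY) \<or> descends (e vX) (e vG))"
  by (simp add: witnessed_def sem_LO sem_H sem_descending)

abbreviation "D1 \<equiv> D (N \<rightharpoonup> N)"
abbreviation "Std1 \<equiv> Std (N \<rightharpoonup> N)"

lemma sem_ATR:
  "sem M ATR e \<longleftrightarrow> (\<forall>X \<in> D1. \<forall>F \<in> D1. linear X \<and> (\<forall>G \<in> D1. \<not> descends X G) \<longrightarrow>
    (\<exists>Y \<in> D1. iterates X F Y))"
  by (simp add: ATR_def WO_eq sem_LO sem_H sem_descending)

lemma sem_relst_ATR:
  assumes e: "std_env e {}"
  shows "sem M (relst ATR) e \<longleftrightarrow> (\<forall>X \<in> D1. Std1 X \<longrightarrow> (\<forall>F \<in> D1. Std1 F \<longrightarrow>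
    linear X \<and> (\<forall>G \<in> D1. Std1 G \<longrightarrow> \<not> descends X G) \<longrightarrow> (\<exists>Y \<in> D1. Std1 Y \<and> iterates X F Y)))"
proof -
  have XF: "std_env (e(vX := X, vF := F)) {vX, vF}"
    if "X \<in> D1" "Std1 X" "F \<in> D1" "Std1 F" for X F
    using e that good_update[of "e(vX := X)" F vF] good_update[of e X vX]
    by (auto simp: std_env_def)
  have upd: "std_env (e(vX := X, vF := F, z := Z)) {vX, vF, z}"
    if "X \<in> D1" "Std1 X" "F \<in> D1" "Std1 F" "snd z = N \<rightharpoonup> N" "Z \<in> D1" "Std1 Z" for X F Z z
    using XF[of X F] that good_update[of "e(vX := X, vF := F)" Z z]
    by (auto simp: std_env_def)
  have lin: "sem M (relst LO) (e(vX := X, vF := F)) \<longleftrightarrow> linear X"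
    if "X \<in> D1" "Std1 X" "F \<in> D1" "Std1 F" for X F
    using transfer[of "e(vX := X, vF := F)" LO] XF[OF that] std_env_mono[of _ _ "{vX}"]
    by (simp add: sem_LO)
  have desc: "sem M (relst descending) (e(vX := X, vF := F, vG := G)) \<longleftrightarrow> descends X G"
    if "X \<in> D1" "Std1 X" "F \<in> D1" "Std1 F" "G \<in> D1" "Std1 G" for X F G
    using transfer[of "e(vX := X, vF := F, vG := G)" descending] upd[of X F vG G] that
      std_env_mono[of _ _ "{vX, vG}"] by (simp add: sem_descending)
  have iter: "sem M (relst H) (e(vX := X, vF := F, vY := Y)) \<longleftrightarrow> iterates X F Y"
    if "X \<in> D1" "Std1 X" "F \<in> D1" "Std1 F" "Y \<in> D1" "Std1 Y" for X F Y
    using transfer[of "e(vX := X, vF := F, vY := Y)" H] upd[of X F vY Y] that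
    by (simp add: sem_H)
  show ?thesis
    by (simp add: relst_ATR relst_WO lin desc iter del: One_nat_def
        cong: ball_cong bex_cong imp_cong conj_cong)
qed

lemma typed_witness_subst: "tyof (witness_subst x) = Some (snd x)"
  by (simp add: witness_subst_def)

text \<open>Choice is applied to the equation representing \<open>witnessed\<close>, whose parameters are the two operators.
  Before \<open>PF-TP\<close> can be used, the equation has to be turned back into \<open>witnessed\<close> itself: only then
  do no parameters remain besides the two functionals.\<close>

lemma witness_functionals:
  assumes e: "std_env e {}"
    and total: "\<And>X F. X \<in> D1 \<Longrightarrow> F \<in> D1 \<Longrightarrow>
      \<exists>Y \<in> D1. \<exists>G \<in> D1. linear X \<longrightarrow> iterates X F Y \<or> descends X G"
  obtains \<Phi> \<Psi> where "\<Phi> \<in> D witness_ty" "\<Psi> \<in> D witness_ty"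
    "Std witness_ty \<Phi>" "Std witness_ty \<Psi>"
    "\<And>X F. X \<in> D1 \<Longrightarrow> F \<in> D1 \<Longrightarrow>
      linear X \<longrightarrow> iterates X F (\<Phi> \<bullet> X \<bullet> F) \<or> descends X (\<Psi> \<bullet> X \<bullet> F)"
proof -
  let ?y = "(4, witness_ty) :: var" and ?g = "(5, witness_ty) :: var"
  let ?A = "Eq (char_tm witnessed) tzero"
  have good: "good_env e" using e by (simp add: std_env_def)
  have fvA: "fv ?A \<subseteq> {vX, vF, vY, vG, mm, dd}" using fvt_char_tm[of witnessed] by auto
  have "foldr Forall [vX, vF] (foldr Exists [vY, vG] ?A) \<^bold>\<longrightarrow>
      foldr Exists [?y, ?g] (foldr Forall [vX, vF] (psubst ?A witness_subst)) \<in> QF_AC 1 1"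
    by (rule QF_AC.intros) (use fvA in \<open>auto simp: fun_eq_iff witness_subst_def\<close>)
  then have "Forall vX (Forall vF (Exists vY (Exists vG ?A))) \<^bold>\<longrightarrow>
      Exists ?y (Exists ?g (Forall vX (Forall vF (psubst ?A witness_subst)))) \<in> theory_ATR"
    by simp
  moreover have "wff (psubst ?A witness_subst)"
    using wff_psubst[OF typed_witness_subst, of ?A] by simp
  ultimately have ac: "sem M (Forall vX (Forall vF (Exists vY (Exists vG ?A)))) e \<Longrightarrow>
      sem M (Exists ?y (Exists ?g (Forall vX (Forall vF (psubst ?A witness_subst))))) e"
    using axiom_sem[of "Forall vX (Forall vF (Exists vY (Exists vG ?A))) \<^bold>\<longrightarrow>
      Exists ?y (Exists ?g (Forall vX (Forall vF (psubst ?A witness_subst))))" e]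
      good_typed[OF good] by simp
  have A: "sem M ?A e' \<longleftrightarrow>
      (linear (e' vX) \<longrightarrow> iterates (e' vX) (e' vF) (e' vY) \<or> descends (e' vX) (e' vG))"
    if "typed_env M e'" "e' mm = e mm" "e' dd = e dd" for e'
    using char_tm_zero[OF good_cong[OF good that], of witnessed] by (simp add: sem_witnessed)
  \<comment> \<open>The hypothesis of choice, stated for the quantifier-free equation.\<close>
  have "sem M (Forall vX (Forall vF (Exists vY (Exists vG ?A)))) e"
    using total good_typed[OF good] by (simp add: A del: sem.simps(1))
  then obtain \<Phi> \<Psi> where fs: "\<Phi> \<in> D witness_ty" "\<Psi> \<in> D witness_ty"
    and sub: "\<And>X F. X \<in> D1 \<Longrightarrow> F \<in> D1 \<Longrightarrow>
      sem M (psubst ?A witness_subst) (e(?y := \<Phi>, ?g := \<Psi>, vX := X, vF := F))"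
    using ac by auto
  have typed_sub: "typed_env M (\<lambda>x. ev M (witness_subst x) e')" if "typed_env M e'" for e'
    unfolding typed_env_def using ev_in_D[OF that typed_witness_subst] by blast
  let ?\<chi> = "Forall vX (Forall vF (psubst witnessed witness_subst))"
  have sem_\<chi>: "sem M ?\<chi> (e(?y := \<Phi>, ?g := \<Psi>))"
  proof -
    have "sem M (psubst witnessed witness_subst) (e(?y := \<Phi>, ?g := \<Psi>, vX := X, vF := F))"
      if "X \<in> D1" "F \<in> D1" for X F
    proof -
      let ?e = "e(?y := \<Phi>, ?g := \<Psi>, vX := X, vF := F)"
      have "typed_env M ?e" using good_typed[OF good] fs that by simp
      then have "sem M ?A (\<lambda>x. ev M (witness_subst x) ?e) \<longleftrightarrow>
          sem M witnessed (\<lambda>x. ev M (witness_subst x) ?e)"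
        by (subst A[OF typed_sub]) (simp_all add: witness_subst_def sem_witnessed)
      then show ?thesis using sub[OF that] unfolding sem_psubst by simp
    qed
    then show ?thesis by simp
  qed
  have wff_\<chi>: "wff ?\<chi>" using wff_psubst[OF typed_witness_subst, of witnessed] by simp
  have internal_\<chi>: "internal ?\<chi>" by (simp add: internal_psubst internal_arith)
  have fv_\<chi>: "fv ?\<chi> \<subseteq> {?y, ?g}"
    using fv_psubst[of witnessed witness_subst] by (auto simp: witness_subst_def)
  have "\<Phi> \<in> D (snd ?y)" "\<Psi> \<in> D (snd ?g)" using fs by simp_all
  from standard_pair[OF wff_\<chi> internal_\<chi> fv_\<chi> good_typed[OF good] this sem_\<chi>]
  obtain \<Phi>' \<Psi>' where fs': "\<Phi>' \<in> D witness_ty" "\<Psi>' \<in> D witness_ty" "Std witness_ty \<Phi>'" "Std witness_ty \<Psi>'"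
    and \<chi>: "sem M ?\<chi> (e(?y := \<Phi>', ?g := \<Psi>'))"
    unfolding snd_conv by blast
  show ?thesis
  proof (rule that[OF fs'])
    fix X F assume "X \<in> D1" "F \<in> D1"
    then have "sem M (psubst witnessed witness_subst)
        (e(?y := \<Phi>', ?g := \<Psi>', vX := X, vF := F))"
      using \<chi> by simp
    then show "linear X \<longrightarrow> iterates X F (\<Phi>' \<bullet> X \<bullet> F) \<or> descends X (\<Psi>' \<bullet> X \<bullet> F)"
      by (simp add: sem_psubst sem_witnessed witness_subst_def)
  qed
qed

text \<open>The values of standard functionals at standard arguments are standard. So a
  descending sequence among them is excluded by the relativised hypothesis, and only the
  alternative of a standard iteration is left.\<close>

lemma ATR_imp_relst:
  assumes e: "std_env e {}" and "sem M ATR e"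
  shows "sem M (relst ATR) e"
proof -
  have "\<exists>Y \<in> D1. \<exists>G \<in> D1. linear X \<longrightarrow> iterates X F Y \<or> descends X G"
    if "X \<in> D1" "F \<in> D1" for X F
    using assms(2) that unfolding sem_ATR by blast
  from witness_functionals[OF e this] obtain \<Phi> \<Psi> where fs: "\<Phi> \<in> D witness_ty"
    "\<Psi> \<in> D witness_ty"
    "Std witness_ty \<Phi>" "Std witness_ty \<Psi>"
    and w: "\<And>X F. X \<in> D1 \<Longrightarrow> F \<in> D1 \<Longrightarrow>
      linear X \<longrightarrow> iterates X F (\<Phi> \<bullet> X \<bullet> F) \<or> descends X (\<Psi> \<bullet> X \<bullet> F)"
    by blast
  have val: "\<Xi> \<bullet> X \<bullet> F \<in> D1" "Std1 (\<Xi> \<bullet> X \<bullet> F)"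
    if "\<Xi> \<in> D witness_ty" "Std witness_ty \<Xi>"
      "X \<in> D1" "Std1 X" "F \<in> D1" "Std1 F" for \<Xi> X F
    using that app_in_D Std_app by blast+
  show ?thesis
    unfolding sem_relst_ATR[OF e]
  proof (intro ballI impI)
    fix X F assume X: "X \<in> D1" "Std1 X" and F: "F \<in> D1" "Std1 F"
      and wo: "linear X \<and> (\<forall>G \<in> D1. Std1 G \<longrightarrow> \<not> descends X G)"
    have "\<not> descends X (\<Psi> \<bullet> X \<bullet> F)" using wo val[OF fs(2,4) X F] by blast
    then have "iterates X F (\<Phi> \<bullet> X \<bullet> F)" using w X F wo by blast
    then show "\<exists>Y \<in> D1. Std1 Y \<and> iterates X F Y" using val[OF fs(1,3) X F] by blast
  qed
qed

text \<open>A counterexample \<open>X, f\<close> to \<open>ATR\<close> has neither an iteration nor a descending sequence. This is an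
  internal property of \<open>X\<close> and \<open>f\<close> alone, so a standard counterexample exists too.\<close>

lemma relst_imp_ATR:
  assumes e: "std_env e {}" and rel: "sem M (relst ATR) e"
  shows "sem M ATR e"
proof (rule ccontr)
  let ?\<phi> = "\<^bold>\<not> Exists vY (Exists vG witnessed)"
  assume "\<not> sem M ATR e"
  then obtain X F where X: "X \<in> D1" and F: "F \<in> D1" and "linear X"
    and none: "\<forall>G \<in> D1. \<not> descends X G" "\<forall>Y \<in> D1. \<not> iterates X F Y"
    unfolding sem_ATR by blast
  then have bad: "sem M ?\<phi> (e(vX := X, vF := F))" by (simp add: sem_witnessed)
  have "wff ?\<phi>" "internal ?\<phi>" "fv ?\<phi> \<subseteq> {vX, vF}"
    by (auto simp: internal_arith)
  moreover have "typed_env M e" using e by (simp add: std_env_def good_typed)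
  moreover have "X \<in> D (snd vX)" "F \<in> D (snd vF)" using X F by simp_all
  ultimately obtain X F where X: "X \<in> D1" "Std1 X" and F: "F \<in> D1" "Std1 F"
    and "sem M ?\<phi> (e(vX := X, vF := F))"
    using bad by (rule standard_pair) (simp only: snd_conv)
  then have "linear X \<and> (\<forall>Y \<in> D1. \<forall>G \<in> D1. \<not> iterates X F Y \<and> \<not> descends X G)"
    by (auto simp: sem_witnessed)
  then show False using rel X F unfolding sem_relst_ATR[OF e] by blast
qed

text \<open>The operators are assigned to variables that the two sentences do not mention.\<close>

lemma ATR_iff_relst: "valid M (ATR \<^bold>\<longleftrightarrow> relst ATR)"
  unfolding valid_def
proof (intro allI impI)
  fix e assume "typed_env M e"
  then obtain m d where std: "std_env (e(mm := m, dd := d)) {}" by (rule standard_operators)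
  have "sem M (ATR \<^bold>\<longleftrightarrow> relst ATR) (e(mm := m, dd := d))"
    using ATR_imp_relst[OF std] relst_imp_ATR[OF std] by simp
  then show "sem M (ATR \<^bold>\<longleftrightarrow> relst ATR) e" by (simp add: fv_relst)
qed

end

theorem theorem4p9:
  shows "B0 \<union> {exists2} \<union> QF_AC 1 1 \<turnstile> ATR \<^bold>\<longleftrightarrow> relst ATR"
proof (rule completeness)
  show "ST \<subseteq> B0 \<union> {exists2} \<union> QF_AC 1 1" by (auto simp: B0_def)
  show "wff (ATR \<^bold>\<longleftrightarrow> relst ATR)" by (simp add: wff_relst)
  fix M :: "tm struct"
  assume M: "typed_struct M" "\<And>\<psi>. \<psi> \<in> theory_ATR \<Longrightarrow> wff \<psi> \<Longrightarrow> valid M \<psi>"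
  show "valid M (ATR \<^bold>\<longleftrightarrow> relst ATR)"
  proof (cases "\<exists>e. typed_env M e")
    case True
    then interpret model M using M by unfold_locales
    show ?thesis by (rule ATR_iff_relst)
  next
    case False
    then show ?thesis by (simp add: valid_def)
  qed
qed

end
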